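(* Let $g>0$, $\Omega>0$, $\rho_0>0$, $d>0$, $\mu\in\mathbb{R}\setminus\{0\}$, and consider the density $\rho(x)=\rho_0+\mu\delta(x-d)+\mu\delta(x+d)$. Let $\lambda(\omega)=\omega-\frac{g^2\rho_0}{\omega-\Omega}$, $\omega_\pm=\frac12\left(\Omega\pm\sqrt{\Omega^2+4g^2\rho_0}\right)$, $G_-=(-\infty,\omega_-)$, $G_+=(\Omega,\omega_+)$, $\kappa(\omega)=\sqrt{-\lambda(\omega)}$ for $\omega\in G_-\cup G_+$, and $$f_e(\omega)=\frac{2\kappa(\omega)(\Omega-\omega)}{g^2\left(1+e^{-2\kappa(\omega)d}\right)},\qquad f_o(\omega)=\frac{2\kappa(\omega)(\Omega-\omega)}{g^2\left(1-e^{-2\kappa(\omega)d}\right)}.$$ A real number $\omega\neq\Omega$ is an even (respectively odd) eigenvalue if and only if $\omega\in G_-\cup G_+$ and $f_e(\omega)=\mu$ (respectively $f_o(\omega)=\mu$). Moreover: (i) If $\mu>0$, all eigenvalues lie in $G_-$. There is exactly one even eigenvalue. With $$\mu_L=\frac{\Omega+\sqrt{\Omega^2+4g^2\rho_0}}{2dg^2},$$ there is exactly one odd eigenvalue if $\mu>\mu_L$ and no odd eigenvalue if $\mu\le\mu_L$. (ii) If $\mu<0$, all eigenvalues lie in $G_+$. Each of $f_e$ and $f_o$ attains its minimum over $G_+$ at a unique point; the minimum values $\mu_e^*=\min_{G_+}f_e$ and $\mu_o^*=\min_{G_+}f_o$ satisfy $\mu_o^*<\mu_e^*<0$. The number of even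 eigenvalues is $0$, $1$ or $2$, the number of odd eigenvalues is $0$, $1$ or $2$, and for all sufficiently negative $\mu$ there are no eigenvalues.
   Context: A real $\omega\neq\Omega$ is called an eigenvalue (bound-state frequency) for this density if the problem $-\psi''+\frac{g^2\mu}{\omega-\Omega}\left(\delta(x-d)+\delta(x+d)\right)\psi=\lambda(\omega)\psi$ has a nonzero solution $\psi\in L^2(\mathbb{R})$. This means: $\psi$ is continuous on $\mathbb{R}$, $-\psi''=\lambda(\omega)\psi$ on $\mathbb{R}\setminus\{-d,d\}$, and at each $a\in\{-d,d\}$ the one-sided derivatives exist and satisfy $-\psi'(a^+)+\psi'(a^-)+\frac{g^2\mu}{\omega-\Omega}\psi(a)=0$. It is an even (odd) eigenvalue if there is such a nonzero solution $\psi$ that is an even (odd) function. Eigenvalues are counted as distinct values of $\omega$. *)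

theory Defs
  imports "HOL-Analysis.Analysis"
begin

definition lam :: "real \<Rightarrow> real \<Rightarrow> real \<Rightarrow> real \<Rightarrow> real" where
  "lam g \<Omega> \<rho>\<^sub>0 \<omega> = \<omega> - g\<^sup>2 * \<rho>\<^sub>0 / (\<omega> - \<Omega>)"

definition omega_minus :: "real \<Rightarrow> real \<Rightarrow> real \<Rightarrow> real" where
  "omega_minus g \<Omega> \<rho>\<^sub>0 = (\<Omega> - sqrt (\<Omega>\<^sup>2 + 4 * g\<^sup>2 * \<rho>\<^sub>0)) / 2"

definition omega_plus :: "real \<Rightarrow> real \<Rightarrow> real \<Rightarrow> real" where
  "omega_plus g \<Omega> \<rho>\<^sub>0 = (\<Omega> + sqrt (\<Omega>\<^sup>2 + 4 * g\<^sup>2 * \<rho>\<^sub>0)) / 2"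

definition G_minus :: "real \<Rightarrow> real \<Rightarrow> real \<Rightarrow> real set" where
  "G_minus g \<Omega> \<rho>\<^sub>0 = {..<omega_minus g \<Omega> \<rho>\<^sub>0}"

definition G_plus :: "real \<Rightarrow> real \<Rightarrow> real \<Rightarrow> real set" where
  "G_plus g \<Omega> \<rho>\<^sub>0 = {\<Omega><..<omega_plus g \<Omega> \<rho>\<^sub>0}"

(* kappa, f_e and f_o are meaningful only for frequencies in G_minus or G_plus, where lam < 0;
   values elsewhere are junk. *)

definition kappa :: "real \<Rightarrow> real \<Rightarrow> real \<Rightarrow> real \<Rightarrow> real" where
  "kappa g \<Omega> \<rho>\<^sub>0 \<omega> = sqrt (- lam g \<Omega> \<rho>\<^sub>0 \<omega>)"

definition f_e :: "real \<Rightarrow> real \<Rightarrow> real \<Rightarrow> real \<Rightarrow> real \<Rightarrow> real" where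
  "f_e g \<Omega> \<rho>\<^sub>0 d \<omega> =
     2 * kappa g \<Omega> \<rho>\<^sub>0 \<omega> * (\<Omega> - \<omega>) / (g\<^sup>2 * (1 + exp (- 2 * kappa g \<Omega> \<rho>\<^sub>0 \<omega> * d)))"

definition f_o :: "real \<Rightarrow> real \<Rightarrow> real \<Rightarrow> real \<Rightarrow> real \<Rightarrow> real" where
  "f_o g \<Omega> \<rho>\<^sub>0 d \<omega> =
     2 * kappa g \<Omega> \<rho>\<^sub>0 \<omega> * (\<Omega> - \<omega>) / (g\<^sup>2 * (1 - exp (- 2 * kappa g \<Omega> \<rho>\<^sub>0 \<omega> * d)))"

definition square_integrable :: "(real \<Rightarrow> complex) \<Rightarrow> bool" where
  "square_integrable \<psi> \<longleftrightarrow>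
     \<psi> \<in> borel_measurable lborel \<and> integrable lborel (\<lambda>x. (cmod (\<psi> x))\<^sup>2)"

(* Nonzero L2 solutions of
     - psi'' + g^2 mu / (omega - Omega) (delta (x - d) + delta (x + d)) psi = lam(omega) psi.
   In the interface condition, p and q are the right and left derivatives of psi at a. *)

definition bound_state ::
  "real \<Rightarrow> real \<Rightarrow> real \<Rightarrow> real \<Rightarrow> real \<Rightarrow> real \<Rightarrow> (real \<Rightarrow> complex) \<Rightarrow> bool" where
  "bound_state g \<Omega> \<rho>\<^sub>0 d \<mu> \<omega> \<psi> \<longleftrightarrow>
     (\<exists>x. \<psi> x \<noteq> 0) \<and>
     square_integrable \<psi> \<and>
     continuous_on UNIV \<psi> \<and>
     (\<exists>\<psi>' \<psi>''. \<forall>x\<in>UNIV - {-d, d}.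
        (\<psi> has_vector_derivative \<psi>' x) (at x) \<and>
        (\<psi>' has_vector_derivative \<psi>'' x) (at x) \<and>
        - \<psi>'' x = lam g \<Omega> \<rho>\<^sub>0 \<omega> *\<^sub>R \<psi> x) \<and>
     (\<forall>a\<in>{-d, d}. \<exists>p q.
        (\<psi> has_vector_derivative p) (at_right a) \<and>
        (\<psi> has_vector_derivative q) (at_left a) \<and>
        - p + q + (g\<^sup>2 * \<mu> / (\<omega> - \<Omega>)) *\<^sub>R \<psi> a = 0)"

definition eigenvalue ::
  "real \<Rightarrow> real \<Rightarrow> real \<Rightarrow> real \<Rightarrow> real \<Rightarrow> real \<Rightarrow> bool" where
  "eigenvalue g \<Omega> \<rho>\<^sub>0 d \<mu> \<omega> \<longleftrightarrow>
     \<omega> \<noteq> \<Omega> \<and> (\<exists>\<psi>. bound_state g \<Omega> \<rho>\<^sub>0 d \<mu> \<omega> \<psi>)"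

definition even_eigenvalue ::
  "real \<Rightarrow> real \<Rightarrow> real \<Rightarrow> real \<Rightarrow> real \<Rightarrow> real \<Rightarrow> bool" where
  "even_eigenvalue g \<Omega> \<rho>\<^sub>0 d \<mu> \<omega> \<longleftrightarrow>
     \<omega> \<noteq> \<Omega> \<and> (\<exists>\<psi>. bound_state g \<Omega> \<rho>\<^sub>0 d \<mu> \<omega> \<psi> \<and> (\<forall>x. \<psi> (- x) = \<psi> x))"

definition odd_eigenvalue ::
  "real \<Rightarrow> real \<Rightarrow> real \<Rightarrow> real \<Rightarrow> real \<Rightarrow> real \<Rightarrow> bool" where
  "odd_eigenvalue g \<Omega> \<rho>\<^sub>0 d \<mu> \<omega> \<longleftrightarrow>
     \<omega> \<noteq> \<Omega> \<and> (\<exists>\<psi>. bound_state g \<Omega> \<rho>\<^sub>0 d \<mu> \<omega> \<psi> \<and> (\<forall>x. \<psi> (- x) = - \<psi> x))"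

definition mu_L :: "real \<Rightarrow> real \<Rightarrow> real \<Rightarrow> real \<Rightarrow> real" where
  "mu_L g \<Omega> \<rho>\<^sub>0 d = (\<Omega> + sqrt (\<Omega>\<^sup>2 + 4 * g\<^sup>2 * \<rho>\<^sub>0)) / (2 * d * g\<^sup>2)"

(* The minimum of f over S, provided that it is attained. *)

definition min_value :: "(real \<Rightarrow> real) \<Rightarrow> real set \<Rightarrow> real" where
  "min_value f S = f (arg_min f (\<lambda>x. x \<in> S))"

end

theory Submission
  imports Defs "HOL-Real_Asymp.Real_Asymp"
begin

text \<open>Spectral part. Outside \<open>{-d, d}\<close> a real or imaginary part of a bound state is a combination
  of the two fundamental solutions of \<open>\<phi>'' = - L \<phi>\<close>. Square integrability forces \<open>L = - k\<^sup>2 < 0\<close>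
  and exponential decay on both half-lines; the jump conditions then fix the initial data at
  \<open>\<plusminus>d\<close>, and comparing the two resulting solutions at \<open>0\<close> gives
  \<open>2 k + c (1 \<plusminus> exp (- 2 k d)) = 0\<close>. Conversely
  \<open>exp (- k \<bar>x - d\<bar>) \<plusminus> exp (- k \<bar>x + d\<bar>)\<close> is a bound state.

  Counting part. Both \<open>f_e\<close> and \<open>f_o\<close> are \<open>2/g\<^sup>2 (\<Omega> - \<omega>) h(\<kappa>(\<omega>))\<close> with increasing \<open>h\<close>. On \<open>G_minus\<close>
  both nonconstant factors decrease. On \<open>G_plus\<close>, the identity
  \<open>2 \<kappa> \<kappa>' (\<omega> - \<Omega>) = - (\<kappa>\<^sup>2 + 2 \<omega> - \<Omega>)\<close> shows that the derivative has the sign of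
  \<open>2 \<omega> - \<Omega> - \<kappa>\<^sup>2 (2 - l) / l\<close> where \<open>l = \<kappa> h'(\<kappa>) / h(\<kappa>)\<close>. Since \<open>\<kappa>\<^sup>2 (2 - l) / l\<close> strictly
  increases with \<open>\<kappa>\<close> and \<open>\<kappa>\<close> decreases with \<open>\<omega>\<close>, this expression is strictly increasing, so it
  changes sign exactly once and \<open>f_e\<close>, \<open>f_o\<close> first decrease and then increase.\<close>

section \<open>Calculus of the dispersion profiles\<close>

text \<open>The fourth-order Taylor remainder is nonnegative. The cubic bound feeds the delicate
  case \<open>s = -1\<close> of the next lemma; the linear one settles the remaining signs.\<close>

lemma exp_cubic_bounds:
  fixes x :: real
  assumes "x > 0"
  shows "exp x > 1 + x" and "exp x \<ge> 1 + x + x\<^sup>2 / 2 + x ^ 3 / 6"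
proof -
  show c: "exp x \<ge> 1 + x + x\<^sup>2 / 2 + x ^ 3 / 6"
    using Maclaurin_exp_le[of x 4] assms by (auto simp: eval_nat_numeral)
  have "x\<^sup>2 / 2 + x ^ 3 / 6 > 0" using assms by (simp add: add_pos_pos)
  thus "exp x > 1 + x" using c by linarith
qed

text \<open>The first three expressions are denominators and numerators of \<open>l\<close> and
  \<open>2 - l\<close>, where \<open>l\<close> is the logarithmic derivative of the profile. The
  last one is, up to the factor \<open>2 * x\<close>, the numerator of the derivative of
  \<open>critN s\<close>.\<close>

lemma exp_sign_inequalities:
  fixes x s :: real
  assumes x: "x > 0" and s: "s = 1 \<or> s = -1"
  shows "exp x + s > 0" "exp x + s * (1 - x) > 0" "exp x + s * (1 + x) > 0"
    and "(exp x + s)\<^sup>2 - x\<^sup>2 + s * x\<^sup>2 * exp x - s * x * exp x - x > 0"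
proof -
  note b = exp_cubic_bounds[OF x]
  show "exp x + s > 0" "exp x + s * (1 - x) > 0" "exp x + s * (1 + x) > 0"
    using s b(1) x by auto
  define E where "E = exp x - 1"
  have E: "E > x" "E \<ge> x + x\<^sup>2 / 2 + x ^ 3 / 6" using b by (auto simp: E_def)
  have eE: "exp x = E + 1" by (simp add: E_def)
  show "(exp x + s)\<^sup>2 - x\<^sup>2 + s * x\<^sup>2 * exp x - s * x * exp x - x > 0"
    using s
  proof
    assume "s = 1"
    have "E * (E - x) > 0" "x\<^sup>2 * E > 0" using E x by auto
    moreover have "(exp x + s)\<^sup>2 - x\<^sup>2 + s * x\<^sup>2 * exp x - s * x * exp x - x
        = E * (E - x) + 4 * E + 4 + x\<^sup>2 * E - 2 * x"
      unfolding eE \<open>s = 1\<close> by (simp add: algebra_simps power2_eq_square)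
    ultimately show ?thesis using E x by linarith
  next
    assume "s = -1"
    \<comment> \<open>In terms of \<open>E\<close> the claim is
      \<open>E * (E - x\<^sup>2 + x) > 2 * x\<^sup>2\<close>. \<open>P\<close> bounds
      \<open>E\<close> from below and \<open>Q = P - x\<^sup>2 + x\<close> bounds the second factor.
      The product \<open>P * Q\<close> starts exactly with \<open>2 * x\<^sup>2\<close>, so the
      higher terms decide; without its cubic term \<open>Q\<close> would turn negative for large
      \<open>x\<close>.\<close>
    define P where "P = x + x\<^sup>2 / 2 + x ^ 3 / 6"
    define Q where "Q = 2 * x - x\<^sup>2 / 2 + x ^ 3 / 6"
    have "Q = x * ((x - 3/2)\<^sup>2 + 39/4) / 6" 
      by (simp add: Q_def power2_eq_square power3_eq_cube field_simps)
    moreover have "(x - 3/2)\<^sup>2 + 39/4 > 0" by (simp add: add_nonneg_pos)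
    ultimately have Q: "Q > 0" using x by (metis mult_pos_pos divide_pos_pos zero_less_numeral)
    have "P * Q = 2 * x\<^sup>2 + x ^ 3 / 2 + x ^ 4 / 4 + x ^ 6 / 36"
      by (simp add: P_def Q_def eval_nat_numeral field_simps)
    moreover have "x ^ 3 / 2 + x ^ 4 / 4 + x ^ 6 / 36 > 0" using x by (simp add: add_pos_pos)
    ultimately have "P * Q > 2 * x\<^sup>2" by linarith
    also have "P * Q \<le> E * (E - x\<^sup>2 + x)"
    proof (rule mult_mono)
      show "P \<le> E" "Q \<le> E - x\<^sup>2 + x" using E by (auto simp: P_def Q_def)
      show "0 \<le> E" "0 \<le> Q" using E x Q by auto
    qed
    finally show ?thesis
      unfolding eE \<open>s = -1\<close> by (simp add: algebra_simps power2_eq_square)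
  qed
qed

text \<open>With \<open>l\<close> the logarithmic derivative \<open>k h'(k) / h(k)\<close> of
  \<open>h(k) = k / (1 + s exp (- 2 k d))\<close> and \<open>x = 2 d k\<close>, this is \<open>x\<^sup>2 (2 - l) / l\<close>. The case
  \<open>s = 1\<close> belongs to the even, the case \<open>s = -1\<close> to the odd states.\<close>

definition critN :: "real \<Rightarrow> real \<Rightarrow> real" where
  "critN s x = x\<^sup>2 * (exp x + s * (1 - x)) / (exp x + s * (1 + x))"

text \<open>By the quotient rule and \<open>s * s = 1\<close> the numerator of the derivative
  collapses to \<open>2 * t\<close> times the last expression of
  \<open>exp_sign_inequalities\<close>.\<close>

lemma critN_strict_mono:
  assumes s: "s = 1 \<or> s = -1" and "0 < x" "x < y"
  shows "critN s x < critN s y"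
proof (rule DERIV_pos_imp_increasing[OF \<open>x < y\<close>])
  fix t assume "x \<le> t" "t \<le> y"
  with assms have t: "t > 0" by simp
  note p = exp_sign_inequalities[OF t s]
  define E where "E = exp t"
  define A where "A = E + s * (1 - t)"
  define B where "B = E + s * (1 + t)"
  have pos: "A > 0" "B > 0" using p by (auto simp: A_def B_def E_def)
  have ss: "s * s = 1" using s by auto
  have "(critN s has_real_derivative
     ((2 * t * A + t\<^sup>2 * (E - s)) * B - t\<^sup>2 * A * (E + s)) / (B * B)) (at t)"
    unfolding critN_def[abs_def] using pos unfolding A_def B_def E_def
    by (auto intro!: derivative_eq_intros simp: algebra_simps)
  moreover have "(2 * t * A + t\<^sup>2 * (E - s)) * B - t\<^sup>2 * A * (E + s)
     = 2 * t * ((E + s)\<^sup>2 - t\<^sup>2 + s * t\<^sup>2 * E - s * t * E - t)"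
    using ss unfolding A_def B_def by algebra
  moreover have "\<dots> > 0" using p t by (simp add: E_def)
  ultimately show "\<exists>y. (critN s has_real_derivative y) (at t) \<and> 0 < y"
    using pos by (metis divide_pos_pos mult_pos_pos)
qed

text \<open>For \<open>s = -1\<close> the denominator vanishes to second order at 0, but the
  numerator to third order, so the limit is 0 for both signs. The two limits later provide the sign
  change of the derivative of the level functions.\<close>

lemma critN_limits:
  assumes s: "s = 1 \<or> s = -1"
  shows "(critN s \<longlongrightarrow> 0) (at_right 0)" "filterlim (critN s) at_top at_top"
proof -
  show "(critN s \<longlongrightarrow> 0) (at_right 0)"
    using s unfolding critN_def[abs_def] by (elim disjE; simp; real_asymp)
  show "filterlim (critN s) at_top at_top"
    using s unfolding critN_def[abs_def] by (elim disjE; simp; real_asymp)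
qed

section \<open>The profile of a given parity as a function of the decay rate\<close>

definition profile :: "real \<Rightarrow> real \<Rightarrow> real \<Rightarrow> real" where
  "profile s d k = k / (1 + s * exp (- 2 * k * d))"

lemma profile_pos:
  assumes "s = 1 \<or> s = -1" "d > 0" "k > 0"
  shows "profile s d k > 0" "1 + s * exp (- 2 * k * d) > 0"
proof -
  have "exp (- 2 * k * d) < 1" "exp (- 2 * k * d) > 0" using assms by auto
  thus *: "1 + s * exp (- 2 * k * d) > 0" using assms(1)
  proof (elim disjE)
    assume "s = 1"
    with \<open>exp (- 2 * k * d) > 0\<close> show ?thesis by (simp only: mult_1_left; linarith)
  next
    assume "s = -1"
    with \<open>exp (- 2 * k * d) < 1\<close> show ?thesis by (simp only: mult_minus1; linarith)
  qed
  show "profile s d k > 0" using * assms by (simp add: profile_def)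
qed

text \<open>The derivative is written as \<open>profile s d k / k\<close> times the logarithmic
  derivative, whose fraction is expanded by \<open>exp x\<close> so that the expressions of
  \<open>exp_sign_inequalities\<close> appear.\<close>

lemma profile_deriv:
  assumes s: "s = 1 \<or> s = -1" and "d > 0" "k > 0"
  defines "x \<equiv> 2 * d * k"
  shows "(profile s d has_real_derivative
           profile s d k / k * ((exp x + s * (1 + x)) / (exp x + s))) (at k)"
proof -
  define e where "e = exp (- 2 * k * d)"
  have e: "e > 0" "1 + s * e > 0" using profile_pos[OF assms(1-3)] by (auto simp: e_def)
  have ex: "exp x = 1 / e" by (simp add: e_def x_def exp_minus field_simps)
  have "(profile s d has_real_derivative
     ((1 + s * e) - k * (s * (e * (- 2 * d)))) / ((1 + s * e) * (1 + s * e))) (at k)"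
    unfolding profile_def[abs_def] e_def using e unfolding e_def
    by (auto intro!: derivative_eq_intros simp: algebra_simps)
  also have "((1 + s * e) - k * (s * (e * (- 2 * d)))) / ((1 + s * e) * (1 + s * e))
     = profile s d k / k * ((exp x + s * (1 + x)) / (exp x + s))"
  proof -
    have "(exp x + s * (1 + x)) / (exp x + s) = (1 + s * e * (1 + x)) / (1 + s * e)"
    proof -
      have "(exp x + s * (1 + x)) / (exp x + s) = (e * (exp x + s * (1 + x))) / (e * (exp x + s))"
        using e by simp
      moreover have "e * (exp x + s * (1 + x)) = 1 + s * e * (1 + x)" "e * (exp x + s) = 1 + s * e"
        using e by (simp_all add: ex algebra_simps)
      ultimately show ?thesis by simp
    qed
    moreover have "profile s d k / k = 1 / (1 + s * e)"
      using assms by (simp add: profile_def e_def)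
    moreover have "(1 + s * e) - k * (s * (e * (- 2 * d))) = 1 + s * e * (1 + x)"
      by (simp add: x_def algebra_simps)
    ultimately show ?thesis by simp
  qed
  finally show ?thesis .
qed

lemma profile_strict_mono:
  assumes s: "s = 1 \<or> s = -1" and "d > 0" "0 < k" "k < k'"
  shows "profile s d k < profile s d k'"
proof (rule DERIV_pos_imp_increasing[OF \<open>k < k'\<close>])
  fix t assume "k \<le> t" "t \<le> k'"
  with assms have t: "t > 0" "2 * d * t > 0" by simp_all
  show "\<exists>y. (profile s d has_real_derivative y) (at t) \<and> 0 < y"
    using profile_pos(1)[OF s \<open>d > 0\<close> t(1)] exp_sign_inequalities[OF t(2) s] t(1)
    by (intro exI[of _ "profile s d t / t * ((exp (2 * d * t) + s * (1 + 2 * d * t)) / (exp (2 * d * t) + s))"]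
        conjI profile_deriv[OF s \<open>d > 0\<close> t(1)]) simp
qed

text \<open>For \<open>s = -1\<close> the denominator vanishes like \<open>2 * k * d\<close>, which
  leaves the nonzero limit \<open>1 / (2 * d)\<close>. This limit is the origin of the threshold
  \<open>mu_L\<close> for odd states.\<close>

lemma profile_limits:
  assumes "d > 0"
  shows "(profile 1 d \<longlongrightarrow> 0) (at_right 0)" "(profile (-1) d \<longlongrightarrow> 1 / (2 * d)) (at_right 0)"
    and "s = 1 \<or> s = -1 \<Longrightarrow> filterlim (profile s d) at_top at_top"
proof -
  show "(profile 1 d \<longlongrightarrow> 0) (at_right 0)"
    using assms unfolding profile_def[abs_def] by real_asymp
  have "(profile (-1) d \<longlongrightarrow> inverse d / 2) (at_right 0)"
    using assms unfolding profile_def[abs_def] by real_asymp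
  thus "(profile (-1) d \<longlongrightarrow> 1 / (2 * d)) (at_right 0)"
    by (simp only: divide_inverse inverse_mult_distrib mult_ac mult_1_left)
  show "filterlim (profile s d) at_top at_top" if "s = 1 \<or> s = -1"
    using that assms unfolding profile_def[abs_def] by (elim disjE; simp; real_asymp)
qed

section \<open>Level sets of monotone and of unimodal functions\<close>

text \<open>The limit \<open>c\<close> is approached strictly from above: any \<open>y\<close>
  between \<open>x\<close> and \<open>b\<close> gives \<open>c \<le> f y < f x\<close>. A level
  above \<open>c\<close> is met by the intermediate value theorem between a point near
  \<open>b\<close> and a point far to the left, and only once by monotonicity.\<close>

lemma ex1_level_strict_antimono_halfline:
  fixes f :: "real \<Rightarrow> real"
  assumes cont: "continuous_on {..<b} f"
    and mono: "\<And>x y. x < y \<Longrightarrow> y < b \<Longrightarrow> f y < f x"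
    and top: "filterlim f at_top at_bot" and lim: "(f \<longlongrightarrow> c) (at_left b)"
  shows "\<mu> > c \<Longrightarrow> \<exists>!x. x < b \<and> f x = \<mu>" and "x < b \<Longrightarrow> f x > c"
proof -
  have above: "f x > c" if "x < b" for x
  proof -
    obtain y where y: "x < y" "y < b" using dense[OF \<open>x < b\<close>] by blast
    have "eventually (\<lambda>z. z \<in> {y<..<b}) (at_left b)"
      using y by (intro eventually_at_left_real)
    hence "eventually (\<lambda>z. f z \<le> f y) (at_left b)"
      by eventually_elim (use mono in \<open>auto intro: less_imp_le\<close>)
    hence "c \<le> f y" by (intro tendsto_upperbound[OF lim]) auto
    also have "f y < f x" using mono y by simp
    finally show ?thesis .
  qed
  then show "x < b \<Longrightarrow> f x > c" .
  assume "\<mu> > c"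
  have "eventually (\<lambda>z. f z < \<mu> \<and> z < b) (at_left b)"
    using order_tendstoD(2)[OF lim \<open>\<mu> > c\<close>] eventually_at_left_real[of "b - 1" b]
    by (auto elim: eventually_elim2)
  then obtain y where y: "f y < \<mu>" "y < b"
    using eventually_happens'[OF trivial_limit_at_left_real] by blast
  have "eventually (\<lambda>z. f z \<ge> \<mu> \<and> z < y) at_bot"
    using top by (intro eventually_conj eventually_gt_at_bot) (simp add: filterlim_at_top)
  then obtain z where z: "f z \<ge> \<mu>" "z < y"
    using eventually_happens'[OF trivial_limit_at_bot_linorder] by blast
  have "continuous_on {z..y} f" using y by (intro continuous_on_subset[OF cont]) auto
  then obtain x where "z \<le> x" "x \<le> y" "f x = \<mu>"
    using IVT2'[of f y \<mu> z] y z by auto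
  hence "x < b \<and> f x = \<mu>" using y by simp
  thus "\<exists>!x. x < b \<and> f x = \<mu>"
  proof (rule ex1I[of _ x])
    fix w assume "w < b \<and> f w = \<mu>"
    thus "w = x" using mono[of x w] mono[of w x] \<open>x < b \<and> f x = \<mu>\<close>
      by (cases x w rule: linorder_cases) auto
  qed
qed

text \<open>The factor \<open>c\<close> is positive, so \<open>K\<close> alone decides the sign of
  the derivative. As \<open>K\<close> is strictly increasing and takes both signs, it has a single
  zero, which is the turning point \<open>m\<close>.\<close>

lemma unimodal_of_deriv_sign:
  fixes f K c :: "real \<Rightarrow> real"
  assumes deriv: "\<And>x. a < x \<Longrightarrow> x < b \<Longrightarrow> (f has_real_derivative c x * K x) (at x)"
    and c: "\<And>x. a < x \<Longrightarrow> x < b \<Longrightarrow> c x > 0"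
    and mono: "\<And>x y. a < x \<Longrightarrow> x < y \<Longrightarrow> y < b \<Longrightarrow> K x < K y"
    and cont: "continuous_on {a<..<b} K"
    and neg: "a < u" "u < b" "K u < 0" and pos: "a < v" "v < b" "K v > 0"
  obtains m where "a < m" "m < b"
    "\<And>x y. a < x \<Longrightarrow> x < y \<Longrightarrow> y \<le> m \<Longrightarrow> f y < f x"
    "\<And>x y. m \<le> x \<Longrightarrow> x < y \<Longrightarrow> y < b \<Longrightarrow> f x < f y"
proof -
  have "u < v" using mono[of v u] neg pos by (cases u v rule: linorder_cases) auto
  have "continuous_on {u..v} K" using neg pos by (intro continuous_on_subset[OF cont]) auto
  then obtain m where m: "u \<le> m" "m \<le> v" "K m = 0"
    using IVT'[of K u 0 v] neg pos \<open>u < v\<close> by auto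
  have ab: "a < m" "m < b" using m neg pos by auto
  have co: "continuous_on {x..y} f" if "a < x" "y < b" for x y
    by (intro continuous_at_imp_continuous_on ballI, rule DERIV_isCont, rule deriv) (use that in auto)
  show thesis
  proof
    show "a < m" "m < b" by fact+
    show "f y < f x" if "a < x" "x < y" "y \<le> m" for x y
    proof (rule DERIV_neg_imp_decreasing_open[OF \<open>x < y\<close>])
      fix t assume t: "x < t" "t < y"
      hence "K t < 0" using mono[of t m] m ab that by simp
      thus "\<exists>z. (f has_real_derivative z) (at t) \<and> z < 0"
        using deriv[of t] c[of t] t that ab by (intro exI[of _ "c t * K t"] conjI) (auto simp: mult_pos_neg)
    qed (use co that ab in auto)
    show "f x < f y" if "m \<le> x" "x < y" "y < b" for x y
    proof (rule DERIV_pos_imp_increasing_open[OF \<open>x < y\<close>])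
      fix t assume t: "x < t" "t < y"
      hence "K t > 0" using mono[of m t] m ab that by simp
      thus "\<exists>z. (f has_real_derivative z) (at t) \<and> z > 0"
        using deriv[of t] c[of t] t that ab by (intro exI[of _ "c t * K t"] conjI) auto
    qed (use co that ab in auto)
  qed
qed

text \<open>Every point other than \<open>m\<close> has a strictly larger value. On each side of
  \<open>m\<close> the function is injective, so a level set has at most one point on each
  side.\<close>

lemma unimodal_arg_min:
  fixes f :: "real \<Rightarrow> real"
  assumes m: "a < m" "m < b"
    and dec: "\<And>x y. a < x \<Longrightarrow> x < y \<Longrightarrow> y \<le> m \<Longrightarrow> f y < f x"
    and inc: "\<And>x y. m \<le> x \<Longrightarrow> x < y \<Longrightarrow> y < b \<Longrightarrow> f x < f y"
  shows "\<exists>!x. is_arg_min f (\<lambda>x. x \<in> {a<..<b}) x"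
    and "min_value f {a<..<b} = f m"
    and "x \<in> {a<..<b} \<Longrightarrow> f m \<le> f x"
    and "finite {x \<in> {a<..<b}. f x = t}" and "card {x \<in> {a<..<b}. f x = t} \<in> {0, 1, 2}"
proof -
  have less: "f m < f x" if "x \<in> {a<..<b}" "x \<noteq> m" for x
    using that dec[of x m] inc[of m x] m by (cases "x < m") auto
  show "x \<in> {a<..<b} \<Longrightarrow> f m \<le> f x" for x using less[of x] by (cases "x = m") auto
  \<comment> \<open>Stated as an equation of predicates, so that the choice operator hidden in
    \<open>min_value\<close> evaluates to \<open>m\<close>.\<close>
  have arg: "is_arg_min f (\<lambda>x. x \<in> {a<..<b}) = (\<lambda>x. x = m)"
  proof (intro ext iffI)
    fix x assume "is_arg_min f (\<lambda>x. x \<in> {a<..<b}) x"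
    thus "x = m" using less[of x] m unfolding is_arg_min_def by fastforce
  next
    fix x assume "x = m"
    thus "is_arg_min f (\<lambda>x. x \<in> {a<..<b}) x"
      using less m unfolding is_arg_min_def by (metis greaterThanLessThan_iff less_asym order_less_irrefl)
  qed
  show "\<exists>!x. is_arg_min f (\<lambda>x. x \<in> {a<..<b}) x" unfolding arg by simp
  show "min_value f {a<..<b} = f m"
    unfolding min_value_def arg_min_def arg by simp
  have at_most_one: "\<exists>u. A \<subseteq> {u}" if "\<And>x y. x \<in> A \<Longrightarrow> y \<in> A \<Longrightarrow> x = y" for A :: "real set"
    using that by (cases "A = {}") blast+
  have "\<exists>u. {x \<in> {a<..<b}. f x = t} \<inter> {..m} \<subseteq> {u}"
  proof (rule at_most_one)
    fix x y assume "x \<in> {x \<in> {a<..<b}. f x = t} \<inter> {..m}" "y \<in> {x \<in> {a<..<b}. f x = t} \<inter> {..m}"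
    thus "x = y" using dec[of x y] dec[of y x] by (cases x y rule: linorder_cases) auto
  qed
  moreover have "\<exists>v. {x \<in> {a<..<b}. f x = t} \<inter> {m..} \<subseteq> {v}"
  proof (rule at_most_one)
    fix x y assume "x \<in> {x \<in> {a<..<b}. f x = t} \<inter> {m..}" "y \<in> {x \<in> {a<..<b}. f x = t} \<inter> {m..}"
    thus "x = y" using inc[of x y] inc[of y x] by (cases x y rule: linorder_cases) auto
  qed
  ultimately obtain u v where "{x \<in> {a<..<b}. f x = t} \<inter> {..m} \<subseteq> {u}"
    "{x \<in> {a<..<b}. f x = t} \<inter> {m..} \<subseteq> {v}" by blast
  hence sub: "{x \<in> {a<..<b}. f x = t} \<subseteq> {u, v}" by fastforce
  thus "finite {x \<in> {a<..<b}. f x = t}" by (rule finite_subset) simp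
  have "card {x \<in> {a<..<b}. f x = t} \<le> card {u, v}" by (rule card_mono) (use sub in auto)
  also have "\<dots> \<le> 2" by (simp add: card_insert_if)
  finally show "card {x \<in> {a<..<b}. f x = t} \<in> {0, 1, 2}" by auto
qed

section \<open>Bound states of the double delta potential\<close>

text \<open>Two combinations of \<open>f\<close> and \<open>f'\<close> have derivative zero, hence
  are constant on the convex set \<open>I\<close>; the identity \<open>CS\<close> inverts these two
  linear relations.\<close>

lemma ode_solution:
  fixes f f' C S :: "real \<Rightarrow> real"
  assumes I: "convex I"
    and f: "\<And>x. x \<in> I \<Longrightarrow> (f has_real_derivative f' x) (at x)"
    and f': "\<And>x. x \<in> I \<Longrightarrow> (f' has_real_derivative - L * f x) (at x)"
    and C: "\<And>x. (C has_real_derivative - L * S x) (at x)"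
    and S: "\<And>x. (S has_real_derivative C x) (at x)"
    and CS: "\<And>x. (C x)\<^sup>2 + L * (S x)\<^sup>2 = 1"
  obtains a b where "\<And>x. x \<in> I \<Longrightarrow> f x = a * C x + b * S x"
    and "\<And>x. x \<in> I \<Longrightarrow> f' x = - L * a * S x + b * C x"
proof -
  have "((\<lambda>x. C x * f x - S x * f' x) has_real_derivative 0) (at x within I)" if "x \<in> I" for x
    by (rule DERIV_subset[OF DERIV_cong[OF DERIV_diff[OF DERIV_mult[OF C f] DERIV_mult[OF S f']]]])
      (use that in \<open>auto simp: algebra_simps\<close>)
  from has_field_derivative_zero_constant[OF I this]
  obtain a where a: "\<And>x. x \<in> I \<Longrightarrow> C x * f x - S x * f' x = a" by blast
  have "((\<lambda>x. L * (S x * f x) + C x * f' x) has_real_derivative 0) (at x within I)" if "x \<in> I" for x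
    by (rule DERIV_subset[OF DERIV_cong[OF DERIV_add[OF DERIV_cmult[OF DERIV_mult[OF S f]] DERIV_mult[OF C f']]]])
      (use that in \<open>auto simp: algebra_simps\<close>)
  from has_field_derivative_zero_constant[OF I this]
  obtain b where b: "\<And>x. x \<in> I \<Longrightarrow> L * (S x * f x) + C x * f' x = b" by blast
  show thesis
  proof
    fix x assume x: "x \<in> I"
    have "a * C x + b * S x = f x * ((C x)\<^sup>2 + L * (S x)\<^sup>2)"
      unfolding a[OF x, symmetric] b[OF x, symmetric] by (simp add: algebra_simps power2_eq_square)
    thus "f x = a * C x + b * S x" by (simp add: CS)
    have "- L * a * S x + b * C x = f' x * ((C x)\<^sup>2 + L * (S x)\<^sup>2)"
      unfolding a[OF x, symmetric] b[OF x, symmetric] by (simp add: algebra_simps power2_eq_square)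
    thus "f' x = - L * a * S x + b * C x" by (simp add: CS)
  qed
qed

text \<open>The last equation is the Wronskian \<open>C S' - C' S = 1\<close>; it makes \<open>C f - S f'\<close> and
  \<open>L S f + C f'\<close> the two constants of integration.\<close>

definition fundamental_system :: "real \<Rightarrow> (real \<Rightarrow> real) \<Rightarrow> (real \<Rightarrow> real) \<Rightarrow> bool" where
  "fundamental_system L C S \<longleftrightarrow> C 0 = 1 \<and> S 0 = 0 \<and>
     (\<forall>x. (C has_real_derivative - L * S x) (at x) \<and> (S has_real_derivative C x) (at x) \<and>
       (C x)\<^sup>2 + L * (S x)\<^sup>2 = 1)"

lemma fundamental_system_0: "fundamental_system 0 (\<lambda>x. 1) (\<lambda>x. x)"
  unfolding fundamental_system_def by simp

lemma fundamental_system_hyperbolic: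
  assumes "k > 0"
  shows "fundamental_system (- k\<^sup>2) (\<lambda>x. cosh (k * x)) (\<lambda>x. sinh (k * x) / k)"
proof -
  have "((\<lambda>x. cosh (k * x)) has_real_derivative - (- k\<^sup>2) * (sinh (k * x) / k)) (at x)" for x
    using assms by (auto intro!: derivative_eq_intros simp: power2_eq_square)
  moreover have "((\<lambda>x. sinh (k * x) / k) has_real_derivative cosh (k * x)) (at x)" for x
    using assms by (auto intro!: derivative_eq_intros)
  moreover have "(cosh (k * x))\<^sup>2 + (- k\<^sup>2) * (sinh (k * x) / k)\<^sup>2 = 1" for x
    using assms by (simp add: power_divide cosh_square_eq)
  ultimately show ?thesis by (simp add: fundamental_system_def)
qed

lemma fundamental_system_trigonometric:
  assumes "k > 0"
  shows "fundamental_system (k\<^sup>2) (\<lambda>x. cos (k * x)) (\<lambda>x. sin (k * x) / k)"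
proof -
  have "((\<lambda>x. cos (k * x)) has_real_derivative - (k\<^sup>2) * (sin (k * x) / k)) (at x)" for x
    using assms by (auto intro!: derivative_eq_intros simp: power2_eq_square)
  moreover have "((\<lambda>x. sin (k * x) / k) has_real_derivative cos (k * x)) (at x)" for x
    using assms by (auto intro!: derivative_eq_intros)
  moreover have "(cos (k * x))\<^sup>2 + k\<^sup>2 * (sin (k * x) / k)\<^sup>2 = 1" for x
    using assms by (simp add: power_divide)
  ultimately show ?thesis by (simp add: fundamental_system_def)
qed

text \<open>Serves the uniqueness argument that runs before the sign of \<open>L\<close> is
  known.\<close>

lemma fundamental_system_ex: "\<exists>C S. fundamental_system L C S"
proof -
  consider "L = 0" | "sqrt L > 0" "L = (sqrt L)\<^sup>2" | "sqrt (- L) > 0" "L = - (sqrt (- L))\<^sup>2"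
    by (cases L "0::real" rule: linorder_cases) simp_all
  thus ?thesis
  proof cases
    case 1
    thus ?thesis using fundamental_system_0 by blast
  next
    case 2
    show ?thesis using fundamental_system_trigonometric[OF 2(1), folded 2(2)] by blast
  next
    case 3
    show ?thesis using fundamental_system_hyperbolic[OF 3(1), folded 3(2)] by blast
  qed
qed

text \<open>The initial data at \<open>c\<close> are one-sided, because a bound state has kinks at
  \<open>d\<close> and \<open>-d\<close>. The combination \<open>h\<close> from
  \<open>ode_solution\<close> is differentiable at \<open>c\<close> and agrees with \<open>f\<close>
  just to the right of \<open>c\<close>; comparing limits and then difference quotients identifies
  its coefficients with \<open>f c\<close> and \<open>p\<close>.\<close>

lemma ode_initial_value:
  fixes f f' :: "real \<Rightarrow> real"
  assumes I: "convex I" "eventually (\<lambda>x. x \<in> I) (at_right c)"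
    and f: "\<And>x. x \<in> I \<Longrightarrow> (f has_real_derivative f' x) (at x)"
    and f': "\<And>x. x \<in> I \<Longrightarrow> (f' has_real_derivative - L * f x) (at x)"
    and p: "(f has_real_derivative p) (at_right c)"
    and CS: "fundamental_system L C S" and x: "x \<in> I"
  shows "f x = f c * C (x - c) + p * S (x - c)"
    and "f' x = - L * f c * S (x - c) + p * C (x - c)"
proof -
  have der: "((\<lambda>x. C (x - c)) has_real_derivative - L * S (x - c)) (at x)"
    "((\<lambda>x. S (x - c)) has_real_derivative C (x - c)) (at x)" for x
    using CS DERIV_shift[of C "- L * S (x - c)" x "- c"] DERIV_shift[of S "C (x - c)" x "- c"]
    by (auto simp: fundamental_system_def)
  obtain a b where ab: "\<And>x. x \<in> I \<Longrightarrow> f x = a * C (x - c) + b * S (x - c)"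
    "\<And>x. x \<in> I \<Longrightarrow> f' x = - L * a * S (x - c) + b * C (x - c)"
    by (rule ode_solution[OF I(1) f f' der]) (use CS in \<open>auto simp: fundamental_system_def\<close>)
  define h where "h = (\<lambda>x. a * C (x - c) + b * S (x - c))"
  have init: "C 0 = 1" "S 0 = 0" using CS by (auto simp: fundamental_system_def)
  have "(h has_real_derivative a * (- L * S (c - c)) + b * C (c - c)) (at c)"
    unfolding h_def by (intro DERIV_add DERIV_cmult der)
  from has_field_derivative_at_within[OF this, of "{c<..}"]
  have h: "(h has_real_derivative b) (at_right c)" by (simp add: init)
  have eq: "eventually (\<lambda>x. f x = h x) (at_right c)"
    using I(2) by eventually_elim (simp add: ab h_def)
  have "(f \<longlongrightarrow> f c) (at_right c)" "(h \<longlongrightarrow> h c) (at_right c)"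
    using DERIV_continuous[OF p] DERIV_continuous[OF h] by (simp_all add: continuous_within)
  from tendsto_unique[OF trivial_limit_at_right_real Lim_transform_eventually[OF this(1) eq] this(2)]
  have fc: "f c = h c" .
  hence a: "f c = a" by (simp add: h_def init)
  have "((\<lambda>x. (f x - f c) / (x - c)) \<longlongrightarrow> p) (at_right c)"
    using p by (simp add: has_field_derivative_iff)
  moreover have "((\<lambda>x. (f x - f c) / (x - c)) \<longlongrightarrow> b) (at_right c)"
  proof (rule Lim_transform_eventually)
    show "((\<lambda>x. (h x - h c) / (x - c)) \<longlongrightarrow> b) (at_right c)"
      using h by (simp add: has_field_derivative_iff)
    show "eventually (\<lambda>x. (h x - h c) / (x - c) = (f x - f c) / (x - c)) (at_right c)"
      using eq by eventually_elim (simp add: fc)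
  qed
  ultimately have "p = b" by (rule tendsto_unique[OF trivial_limit_at_right_real])
  thus "f x = f c * C (x - c) + p * S (x - c)"
    and "f' x = - L * f c * S (x - c) + p * C (x - c)" using ab[OF x] a by simp_all
qed

section \<open>Decay forced by square integrability\<close>

text \<open>On an interval of length \<open>n\<close> to the right of \<open>c\<close> the integral
  is at least \<open>m * n\<close>, which is unbounded in \<open>n\<close> if \<open>m\<close> is
  positive.\<close>

lemma integrable_lower_bound_halfline:
  fixes h :: "real \<Rightarrow> real"
  assumes int: "integrable lborel h" and nonneg: "\<And>x. 0 \<le> h x" and low: "\<And>x. x > c \<Longrightarrow> m \<le> h x"
  shows "m \<le> 0"
proof (rule ccontr)
  assume "\<not> m \<le> 0"
  hence m: "m > 0" by simp
  have *: "m * real n \<le> integral\<^sup>L lborel h" for n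
  proof -
    have "integral\<^sup>L lborel (\<lambda>x. m * indicator {c<..<c + real n} x) \<le> integral\<^sup>L lborel h"
    proof (rule integral_mono)
      show "integrable lborel (\<lambda>x. m * indicator {c<..<c + real n} x)"
        by (intro integrable_mult_right integrable_real_indicator) simp_all
      show "m * indicator {c<..<c + real n} x \<le> h x" for x
        using nonneg low by (simp add: indicator_def)
    qed (fact int)
    thus ?thesis by simp
  qed
  obtain n where "real n > integral\<^sup>L lborel h / m" using reals_Archimedean2 by blast
  hence "integral\<^sup>L lborel h < m * real n" using m by (simp add: field_simps)
  with *[of n] show False by simp
qed

text \<open>Comparing a solution with a translate of itself isolates its non-decaying part: the
  combination on the left-hand side can be chosen bounded below by a positive constant unless that
  part vanishes.\<close>

lemma square_integrable_shift_combination: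
  fixes f :: "real \<Rightarrow> real"
  assumes f: "integrable lborel (\<lambda>x. (f x)\<^sup>2)"
    and low: "\<And>x. x > c \<Longrightarrow> m \<le> a * (f (x + h))\<^sup>2 + b * (f x)\<^sup>2" and ab: "a \<ge> 0" "b \<ge> 0"
  shows "m \<le> 0"
proof (rule integrable_lower_bound_halfline)
  have "integrable lborel (\<lambda>x. (f (h + 1 * x))\<^sup>2)"
    using lborel_integrable_real_affine[OF f, of 1 h] by simp
  thus "integrable lborel (\<lambda>x. a * (f (x + h))\<^sup>2 + b * (f x)\<^sup>2)"
    using f by (intro Bochner_Integration.integrable_add integrable_mult_right) (simp_all add: add.commute)
qed (use low ab in auto)

text \<open>Only a decaying exponential survives: a linear function, an oscillation and a growing
  exponential are each excluded by a suitable translate. For \<open>L \<ge> 0\<close> the first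
  equation reads \<open>0 = 0\<close>, whatever value \<open>sqrt (- L)\<close> has.\<close>

lemma square_integrable_ode_halfline:
  fixes f f' :: "real \<Rightarrow> real"
  assumes f: "\<And>x. x > c \<Longrightarrow> (f has_real_derivative f' x) (at x)"
    and f': "\<And>x. x > c \<Longrightarrow> (f' has_real_derivative - L * f x) (at x)"
    and p: "(f has_real_derivative p) (at_right c)"
    and int: "integrable lborel (\<lambda>x. (f x)\<^sup>2)"
  shows "p = - sqrt (- L) * f c \<and> (L \<ge> 0 \<longrightarrow> f c = 0 \<and> p = 0)"
proof -
  have sol: "f x = f c * C (x - c) + p * S (x - c)" if "fundamental_system L C S" "x > c" for C S x
    using that by (intro ode_initial_value(1)[of "{c<..}", OF _ _ f f' p])
      (simp_all add: eventually_at_right_less)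
  have sq_diff: "(u - v)\<^sup>2 \<le> 2 * u\<^sup>2 + 2 * v\<^sup>2" for u v :: real
    using zero_le_power2[of "u + v"] by (simp add: power2_eq_square algebra_simps)
  have rotation: "(- a * u + b * v)\<^sup>2 + (a * v + b * u)\<^sup>2 = (a\<^sup>2 + b\<^sup>2) * (u\<^sup>2 + v\<^sup>2)" for a b u v :: real
    by (simp add: power2_eq_square algebra_simps)
  consider "L = 0" | "L > 0" | "L < 0" by linarith
  thus ?thesis
  proof cases
    assume "L = 0"
    hence s: "f x = f c + p * (x - c)" if "x > c" for x
      using sol[of "\<lambda>x. 1" "\<lambda>x. x" x] fundamental_system_0 that by simp
    have "p\<^sup>2 \<le> 0"
    proof (rule square_integrable_shift_combination[OF int, of c _ 2 1 2])
      fix x assume "x > c"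
      hence "p = f (x + 1) - f x" by (simp add: s algebra_simps)
      thus "p\<^sup>2 \<le> 2 * (f (x + 1))\<^sup>2 + 2 * (f x)\<^sup>2"
        using sq_diff by simp
    qed simp_all
    hence "p = 0" by simp
    have "(f c)\<^sup>2 \<le> 0"
      by (rule square_integrable_shift_combination[OF int, of c _ 0 0 1]) (simp_all add: s \<open>p = 0\<close>)
    thus ?thesis using \<open>p = 0\<close> by simp
  next
    assume "L > 0"
    define k where "k = sqrt L"
    have k: "k > 0" "L = k\<^sup>2" using \<open>L > 0\<close> by (simp_all add: k_def)
    have s: "f x = f c * cos (k * (x - c)) + p * (sin (k * (x - c)) / k)" if "x > c" for x
      using sol[of "\<lambda>x. cos (k * x)" "\<lambda>x. sin (k * x) / k"] fundamental_system_trigonometric[OF k(1)] k(2) that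
      by simp
    have "(f c)\<^sup>2 + (p / k)\<^sup>2 \<le> 0"
    \<comment> \<open>A shift by a quarter period exchanges sine and cosine up to sign, so the two
      squares add up to the constant squared amplitude.\<close>
    proof (rule square_integrable_shift_combination[OF int, of c _ 1 "pi / 2 / k" 1])
      fix x assume x: "x > c"
      define t where "t = k * (x - c)"
      have "k * (x + pi / 2 / k - c) = t + pi / 2" using k by (simp add: t_def field_simps)
      moreover have "x + pi / 2 / k > c" using x k(1) by (intro less_trans[OF x]) simp
      ultimately have "f (x + pi / 2 / k) = - f c * sin t + p / k * cos t"
        using s[of "x + pi / 2 / k"] by (simp add: sin_add cos_add)
      moreover have "f x = f c * cos t + p / k * sin t" using s[OF x] by (simp add: t_def)
      ultimately have "1 * (f (x + pi / 2 / k))\<^sup>2 + 1 * (f x)\<^sup>2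
          = ((f c)\<^sup>2 + (p / k)\<^sup>2) * ((sin t)\<^sup>2 + (cos t)\<^sup>2)"
        by (simp only: mult_1_left rotation)
      thus "(f c)\<^sup>2 + (p / k)\<^sup>2 \<le> 1 * (f (x + pi / 2 / k))\<^sup>2 + 1 * (f x)\<^sup>2" by simp
    qed simp_all
    hence "f c = 0 \<and> p / k = 0" by (simp add: sum_power2_le_zero_iff)
    thus ?thesis using k by simp
  next
    assume "L < 0"
    define k where "k = sqrt (- L)"
    have k: "k > 0" "L = - k\<^sup>2" using \<open>L < 0\<close> by (simp_all add: k_def)
    \<comment> \<open>\<open>A\<close> and \<open>B\<close> are the amplitudes of the growing and of
      the decaying exponential.\<close>
    define A where "A = (f c + p / k) / 2"
    define B where "B = (f c - p / k) / 2"
    have s: "f x = A * exp (k * (x - c)) + B * exp (- (k * (x - c)))" if "x > c" for x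
    proof -
      have "f x = f c * cosh (k * (x - c)) + p * (sinh (k * (x - c)) / k)"
        using sol[of "\<lambda>x. cosh (k * x)" "\<lambda>x. sinh (k * x) / k"] fundamental_system_hyperbolic[OF k(1)] k(2) that
        by simp
      moreover have "f c = A + B" by (simp add: A_def B_def field_simps)
      moreover have "p * (t / k) = (A - B) * t" for t using k(1) by (simp add: A_def B_def field_simps)
      ultimately have "f x = (A + B) * cosh (k * (x - c)) + (A - B) * sinh (k * (x - c))" by simp
      also have "\<dots> = A * (cosh (k * (x - c)) + sinh (k * (x - c))) + B * (cosh (k * (x - c)) - sinh (k * (x - c)))"
        by (simp add: algebra_simps)
      finally show ?thesis by (simp only: cosh_plus_sinh cosh_minus_sinh)
    qed
    have "(A * (exp k - exp (- k)))\<^sup>2 \<le> 0"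
    \<comment> \<open>The difference \<open>f (x + 1) - exp (- k) * f x\<close> cancels the decaying
      exponential and keeps a multiple of the growing one; the weights are those of
      \<open>sq_diff\<close>.\<close>
    proof (rule square_integrable_shift_combination[OF int, of c _ 2 1 "2 * (exp (- k))\<^sup>2"])
      fix x assume x: "x > c"
      define e where "e = exp (k * (x - c))"
      have e: "e \<ge> 1" using x k by (simp add: e_def)
      have "exp (k * (x + 1 - c)) = e * exp k" "exp (- (k * (x + 1 - c))) = exp (- (k * (x - c))) * exp (- k)"
        by (simp_all add: e_def algebra_simps flip: exp_add)
      hence "f (x + 1) - exp (- k) * f x = e * (A * (exp k - exp (- k)))"
        using s[of x] s[of "x + 1"] x by (simp add: e_def algebra_simps)
      hence "(A * (exp k - exp (- k)))\<^sup>2 * e\<^sup>2 = (f (x + 1) - exp (- k) * f x)\<^sup>2"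
        by (simp add: power_mult_distrib)
      also have "\<dots> \<le> 2 * (f (x + 1))\<^sup>2 + 2 * (exp (- k))\<^sup>2 * (f x)\<^sup>2"
        using sq_diff[of "f (x + 1)" "exp (- k) * f x"] by (simp add: power_mult_distrib)
      also have "(A * (exp k - exp (- k)))\<^sup>2 * 1 \<le> (A * (exp k - exp (- k)))\<^sup>2 * e\<^sup>2"
        using e by (intro mult_left_mono one_le_power) auto
      finally show "(A * (exp k - exp (- k)))\<^sup>2 \<le> 2 * (f (x + 1))\<^sup>2 + 2 * (exp (- k))\<^sup>2 * (f x)\<^sup>2"
        by simp
    qed simp_all
    hence "A * (exp k - exp (- k)) = 0" by simp
    moreover have "exp (- k) < exp k" using k by simp
    ultimately have "A = 0" by simp
    hence "p = - k * f c" using k by (simp add: A_def field_simps)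
    thus ?thesis using \<open>L < 0\<close> by (simp add: k_def)
  qed
qed

section \<open>Necessary conditions at the two delta points\<close>

text \<open>Here \<open>L\<close> stands for the value of \<open>lam\<close> and \<open>c\<close>
  for the coupling \<open>g\<^sup>2 * \<mu> / (\<omega> - \<Omega>)\<close>. Continuity is contained
  in the derivatives: the one-sided ones give it at \<open>d\<close> and \<open>-d\<close>.\<close>

definition real_bound_state :: "real \<Rightarrow> real \<Rightarrow> real \<Rightarrow> (real \<Rightarrow> real) \<Rightarrow> bool" where
  "real_bound_state L c d \<phi> \<longleftrightarrow>
     (\<exists>x. \<phi> x \<noteq> 0) \<and> integrable lborel (\<lambda>x. (\<phi> x)\<^sup>2) \<and>
     (\<exists>\<phi>'. \<forall>x\<in>UNIV - {-d, d}. (\<phi> has_real_derivative \<phi>' x) (at x) \<and>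
        (\<phi>' has_real_derivative - L * \<phi> x) (at x)) \<and>
     (\<forall>a\<in>{-d, d}. \<exists>p q. (\<phi> has_real_derivative p) (at_right a) \<and>
        (\<phi> has_real_derivative q) (at_left a) \<and> - p + q + c * \<phi> a = 0)"

text \<open>Reflection moves left-sided data to the right, where the half-line and initial value
  lemmas are stated.\<close>

lemma has_real_derivative_reflect_left:
  assumes "(\<phi> has_real_derivative q) (at_left (- a))"
  shows "((\<lambda>y. \<phi> (- y)) has_real_derivative - q) (at_right (a::real))"
  using DERIV_image_chain[of \<phi> q uminus a "{a<..}" "-1"] DERIV_minus[OF DERIV_ident, of a "{a<..}"] assms
  by (simp add: o_def)

lemma has_real_derivative_reflect:
  assumes "(\<phi> has_real_derivative q) (at (- x))"
  shows "((\<lambda>y. \<phi> (- y)) has_real_derivative - q) (at (x::real))"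
  using assms by (simp add: DERIV_mirror)

text \<open>Decay fixes the outer derivatives at \<open>d\<close> and \<open>-d\<close>, and the
  jumps then fix the inner ones. Continuing the solution from both ends to the midpoint 0 and
  comparing yields \<open>(\<phi> (-d) - \<phi> d) * u = 0\<close> and
  \<open>(\<phi> (-d) + \<phi> d) * v = 0\<close>, where \<open>u\<close> and \<open>v\<close> are
  positive multiples of the odd and the even secular expression.\<close>

lemma real_bound_state_conditions:
  assumes \<phi>: "real_bound_state L c d \<phi>" and d: "d > 0"
  shows "L < 0" and "\<phi> d \<noteq> 0 \<or> \<phi> (-d) \<noteq> 0"
    and "\<phi> (-d) \<noteq> \<phi> d \<Longrightarrow>
           2 * sqrt (- L) + c * (1 - exp (- 2 * sqrt (- L) * d)) = 0"
    and "\<phi> (-d) \<noteq> - \<phi> d \<Longrightarrow>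
           2 * sqrt (- L) + c * (1 + exp (- 2 * sqrt (- L) * d)) = 0"
proof -
  define k where "k = sqrt (- L)"
  obtain \<phi>' where \<phi>': "\<And>x. x \<noteq> d \<Longrightarrow> x \<noteq> -d \<Longrightarrow> (\<phi> has_real_derivative \<phi>' x) (at x)"
    "\<And>x. x \<noteq> d \<Longrightarrow> x \<noteq> -d \<Longrightarrow> (\<phi>' has_real_derivative - L * \<phi> x) (at x)"
    using \<phi> unfolding real_bound_state_def by auto
  obtain p q where pq: "(\<phi> has_real_derivative p) (at_right d)" "(\<phi> has_real_derivative q) (at_left d)"
    "- p + q + c * \<phi> d = 0" using \<phi> unfolding real_bound_state_def by blast
  obtain p' q' where pq': "(\<phi> has_real_derivative p') (at_right (-d))"
    "(\<phi> has_real_derivative q') (at_left (-d))"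
    "- p' + q' + c * \<phi> (-d) = 0" using \<phi> unfolding real_bound_state_def by blast
  have int: "integrable lborel (\<lambda>x. (\<phi> x)\<^sup>2)" using \<phi> unfolding real_bound_state_def by blast
  have int': "integrable lborel (\<lambda>x. (\<phi> (- x))\<^sup>2)"
    using lborel_integrable_real_affine[OF int, of "-1" 0] by simp
  define r where "r = (\<lambda>x. \<phi> (- x))"
  define r' where "r' = (\<lambda>x. - \<phi>' (- x))"
  have r: "(r has_real_derivative r' x) (at x)" "(r' has_real_derivative - L * r x) (at x)"
    if "x \<noteq> d" "x \<noteq> -d" for x
  proof -
    have ne: "- x \<noteq> d" "- x \<noteq> - d" using that by auto
    show "(r has_real_derivative r' x) (at x)"
      using has_real_derivative_reflect[OF \<phi>'(1)[OF ne]] by (simp add: r_def r'_def)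
    show "(r' has_real_derivative - L * r x) (at x)"
      using DERIV_minus[OF has_real_derivative_reflect[OF \<phi>'(2)[OF ne]]] by (simp add: r_def r'_def)
  qed
  have rq: "(r has_real_derivative - q') (at_right d)" "(r has_real_derivative - q) (at_right (- d))"
    unfolding r_def using pq(2) pq'(2) by (auto intro: has_real_derivative_reflect_left)
  have right: "p = - k * \<phi> d \<and> (L \<ge> 0 \<longrightarrow> \<phi> d = 0 \<and> p = 0)"
    unfolding k_def using d by (intro square_integrable_ode_halfline[OF \<phi>'(1) \<phi>'(2) pq(1) int]) auto
  have "- q' = - k * r d \<and> (L \<ge> 0 \<longrightarrow> r d = 0 \<and> - q' = 0)"
    unfolding k_def using d int' by (intro square_integrable_ode_halfline[OF r(1) r(2) rq(1)]) (auto simp: r_def)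
  hence left: "- q' = - k * \<phi> (- d) \<and> (L \<ge> 0 \<longrightarrow> \<phi> (-d) = 0 \<and> - q' = 0)" by (simp add: r_def)
  have mid: "eventually (\<lambda>x. x \<in> {-d<..<d}) (at_right (-d))"
    using d by (intro eventually_at_right_real) auto
  show nz: "\<phi> d \<noteq> 0 \<or> \<phi> (-d) \<noteq> 0"
  \<comment> \<open>If both values vanish, decay and the jump conditions make all four one-sided
    derivatives vanish, and uniqueness annihilates \<open>\<phi>\<close> on each of the three
    intervals.\<close>
  proof (rule ccontr)
    assume "\<not> ?thesis"
    hence z: "\<phi> d = 0" "\<phi> (-d) = 0" by auto
    with left right pq(3) pq'(3) have z': "p = 0" "q = 0" "p' = 0" "q' = 0" by auto
    obtain C S where CS: "fundamental_system L C S" using fundamental_system_ex by blast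
    have "\<phi> x = 0" if "x > d" for x
      using ode_initial_value(1)[OF _ _ \<phi>' pq(1) CS, of "{d<..}" x] that d
      by (auto simp: z z' eventually_at_right_less)
    moreover have "r x = 0" if "x > d" for x
      using ode_initial_value(1)[OF _ _ r rq(1) CS, of "{d<..}" x] that d
      by (auto simp: z z' r_def eventually_at_right_less)
    moreover have "\<phi> x = 0" if "-d < x" "x < d" for x
      using ode_initial_value(1)[OF _ mid \<phi>' pq'(1) CS, of x] that d
      by (auto simp: z z')
    ultimately have "\<phi> x = 0" for x
      using z unfolding r_def
      by (metis add.inverse_inverse less_minus_iff linorder_neqE_linordered_idom)
    thus False using \<phi> unfolding real_bound_state_def by blast
  qed
  show L: "L < 0" using nz left right by linarith
  hence k: "k > 0" "L = - k\<^sup>2" by (simp_all add: k_def)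
  note CS = fundamental_system_hyperbolic[OF k(1), folded k(2)]
  \<comment> \<open>These are the derivatives pointing into the middle interval, each
    \<open>k + c\<close> times the value at its endpoint.\<close>
  have q: "- q = (k + c) * \<phi> d" "p' = (k + c) * \<phi> (-d)"
    using left right pq(3) pq'(3) by (auto simp: algebra_simps)
  have "0 \<in> {-d<..<d}" using d by auto
  \<comment> \<open>Both continuations start at \<open>-d\<close>: one for \<open>\<phi>\<close>,
    the other for the reflection \<open>r\<close>, which carries the data at
    \<open>d\<close>.\<close>
  note at0 = ode_initial_value[OF convex_real_interval(8) mid _ _ pq'(1) CS this]
    ode_initial_value[OF convex_real_interval(8) mid _ _ rq(2) CS this]
  \<comment> \<open>\<open>u / k\<close> and \<open>v\<close> are the value and the derivative at 0
    of the solution that starts at \<open>-d\<close> with value 1 and derivative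
    \<open>k + c\<close>.\<close>
  define u where "u = k * cosh (k * d) + (k + c) * sinh (k * d)"
  define v where "v = k * sinh (k * d) + (k + c) * cosh (k * d)"
  define w where "w = sinh (k * d) / k"
  have w: "sinh (k * d) = k * w" using k(1) by (simp add: w_def)
  have "\<phi> 0 = \<phi> (-d) * cosh (k * d) + p' * w"
    "\<phi>' 0 = k * k * \<phi> (-d) * w + p' * cosh (k * d)"
    "\<phi> 0 = \<phi> d * cosh (k * d) + - q * w"
    "- \<phi>' 0 = k * k * \<phi> d * w + - q * cosh (k * d)"
    unfolding w_def
    using at0(1,2)[of \<phi>'] at0(3,4)[of r'] \<phi>' r d
    by (simp_all add: r_def r'_def k(2) power2_eq_square)
  note initial = this[unfolded q]
  have "k * \<phi> 0 = \<phi> (-d) * u" unfolding initial(1) u_def w by (simp add: algebra_simps)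
  moreover have "\<phi>' 0 = \<phi> (-d) * v" unfolding initial(2) v_def w by (simp add: algebra_simps)
  moreover have "k * \<phi> 0 = \<phi> d * u" unfolding initial(3) u_def w by (simp add: algebra_simps)
  moreover have "- \<phi>' 0 = \<phi> d * v" unfolding initial(4) v_def w by (simp add: algebra_simps)
  ultimately have "\<phi> (-d) * u = \<phi> d * u" "\<phi> (-d) * v = - (\<phi> d * v)" by linarith+
  hence uv: "(\<phi> (-d) - \<phi> d) * u = 0" "(\<phi> (-d) + \<phi> d) * v = 0"
    by (simp_all only: left_diff_distrib distrib_right diff_self left_minus)
  have e: "exp (- 2 * k * d) = exp (- (k * d)) * exp (- (k * d))" "exp (k * d) * exp (- (k * d)) = 1"
    "2 * cosh (k * d) = exp (k * d) + exp (- (k * d))" "2 * sinh (k * d) = exp (k * d) - exp (- (k * d))"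
    by (simp_all add: cosh_field_def sinh_field_def flip: exp_add)
  have "2 * u * exp (- (k * d)) = 2 * k + c * (1 - exp (- 2 * k * d))"
  proof -
    have "2 * u * exp (- (k * d))
        = (k * (2 * cosh (k * d)) + (k + c) * (2 * sinh (k * d))) * exp (- (k * d))"
      by (simp add: u_def algebra_simps)
    thus ?thesis unfolding e(1,3,4) using e(2) by (simp add: algebra_simps)
  qed
  moreover have "2 * v * exp (- (k * d)) = 2 * k + c * (1 + exp (- 2 * k * d))"
  proof -
    have "2 * v * exp (- (k * d))
        = (k * (2 * sinh (k * d)) + (k + c) * (2 * cosh (k * d))) * exp (- (k * d))"
      by (simp add: v_def algebra_simps)
    thus ?thesis unfolding e(1,3,4) using e(2) by (simp add: algebra_simps)
  qed
  ultimately show "\<phi> (-d) \<noteq> \<phi> d \<Longrightarrow> 2 * sqrt (- L) + c * (1 - exp (- 2 * sqrt (- L) * d)) = 0"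
    and "\<phi> (-d) \<noteq> - \<phi> d \<Longrightarrow> 2 * sqrt (- L) + c * (1 + exp (- 2 * sqrt (- L) * d)) = 0"
    using uv unfolding k_def[symmetric] by (simp_all add: eq_neg_iff_add_eq_0)
qed

section \<open>Explicit bound states built from two exponentials\<close>

text \<open>A half-line exponential plus its mirror image dominates the two-sided one. At 0 the sum
  is 2, hence a bound and not an equation; a translation then brings in \<open>b\<close>.\<close>

lemma integrable_exp_minus_abs:
  fixes a :: real
  assumes "a > 0"
  shows "integrable lborel (\<lambda>x. exp (- a * \<bar>x - b\<bar>))"
proof -
  define h where "h = (\<lambda>x. indicator {0..} x *\<^sub>R exp (- a * x))"
  have [measurable]: "h \<in> borel_measurable borel" unfolding h_def by measurable
  have "integrable lebesgue h" unfolding h_def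
    using assms by (intro nonnegative_absolutely_integrable_1[unfolded set_integrable_def]
        integrable_on_exp_minus_to_infinity) auto
  hence h: "integrable lborel h" by (subst (asm) integrable_completion) simp_all
  have "integrable lborel (\<lambda>x. h (0 + -1 * x))"
    by (rule lborel_integrable_real_affine[OF h]) simp
  with h have "integrable lborel (\<lambda>x. h x + h (- x))" by simp
  moreover have "(\<lambda>x. exp (- a * \<bar>x\<bar>)) \<in> borel_measurable lborel" by measurable
  moreover have "norm (exp (- a * \<bar>x\<bar>)) \<le> norm (h x + h (- x))" for x
    by (cases "x \<ge> 0") (auto simp: h_def)
  ultimately have "integrable lborel (\<lambda>x. exp (- a * \<bar>x\<bar>))"
    by (rule Bochner_Integration.integrable_bound[OF _ _ AE_I2])
  from lborel_integrable_real_affine[OF this, of 1 "- b"] show ?thesis by simp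
qed

text \<open>Away from \<open>b\<close> this is a smooth exponential; at \<open>b\<close> the slope
  drops from \<open>k\<close> to \<open>- k\<close>, which supplies the jump demanded by the delta
  interaction.\<close>

lemma exp_abs_derivs:
  fixes k b :: real
  defines "e \<equiv> \<lambda>x. exp (- k * \<bar>x - b\<bar>)"
  defines "e' \<equiv> \<lambda>x. - k * sgn (x - b) * exp (- k * \<bar>x - b\<bar>)"
  shows "x \<noteq> b \<Longrightarrow> (e has_real_derivative e' x) (at x)"
    and "x \<noteq> b \<Longrightarrow> (e' has_real_derivative k\<^sup>2 * e x) (at x)"
    and "(e has_real_derivative - k) (at_right b)"
    and "(e has_real_derivative k) (at_left b)"
proof -
  have E: "((\<lambda>x. exp (s * (x - b))) has_real_derivative s * exp (s * (x - b))) (at x within A)" for s x A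
    by (auto intro!: derivative_eq_intros)
  have E': "((\<lambda>x. s * exp (s * (x - b))) has_real_derivative s * (s * exp (s * (x - b)))) (at x)" for s x
    by (intro DERIV_cmult E)
  show "(e has_real_derivative e' x) (at x)" if "x \<noteq> b"
  proof (cases "x > b")
    case True
    show ?thesis
      by (rule has_field_derivative_transform_within_open[OF DERIV_cong[OF E[of "- k"]], of _ _ "{b<..}"])
        (use True in \<open>auto simp: e_def e'_def\<close>)
  next
    case False
    show ?thesis
      by (rule has_field_derivative_transform_within_open[OF DERIV_cong[OF E[of k]], of _ _ "{..<b}"])
        (use False that in \<open>auto simp: e_def e'_def right_diff_distrib\<close>)
  qed
  show "(e' has_real_derivative k\<^sup>2 * e x) (at x)" if "x \<noteq> b"
  proof (cases "x > b")
    case True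
    show ?thesis
      by (rule has_field_derivative_transform_within_open[OF DERIV_cong[OF E'[of "- k"]], of _ _ "{b<..}"])
        (use True in \<open>auto simp: e_def e'_def power2_eq_square\<close>)
  next
    case False
    show ?thesis
      by (rule has_field_derivative_transform_within_open[OF DERIV_cong[OF E'[of k]], of _ _ "{..<b}"])
        (use False that in \<open>auto simp: e_def e'_def power2_eq_square right_diff_distrib\<close>)
  qed
  have "(e has_real_derivative - k) (at b within {b..})"
    by (rule has_field_derivative_transform_within[where d = 1, OF DERIV_cong[OF E[of "- k"]]])
      (auto simp: e_def)
  thus "(e has_real_derivative - k) (at_right b)" by (rule DERIV_subset) auto
  have "(e has_real_derivative k) (at b within {..b})"
    by (rule has_field_derivative_transform_within[where d = 1, OF DERIV_cong[OF E[of k]]])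
      (auto simp: e_def right_diff_distrib)
  thus "(e has_real_derivative k) (at_left b)" by (rule DERIV_subset) auto
qed

text \<open>At \<open>d\<close> only the exponential centred there has a kink, so the slopes of the
  other one cancel and the interface condition is exactly \<open>cond\<close>. At \<open>-d\<close>
  it is \<open>s\<close> times \<open>cond\<close>, because \<open>s * s = 1\<close>.\<close>

lemma bound_state_exponential:
  fixes k d s :: real
  assumes k: "k > 0" "lam g \<Omega> \<rho> \<omega> = - k\<^sup>2" and d: "d > 0" and s: "s = 1 \<or> s = -1"
    and cond: "2 * k + g\<^sup>2 * \<mu> / (\<omega> - \<Omega>) * (1 + s * exp (- 2 * k * d)) = 0"
  shows "bound_state g \<Omega> \<rho> d \<mu> \<omega>
    (\<lambda>x. complex_of_real (exp (- k * \<bar>x - d\<bar>) + s * exp (- k * \<bar>x + d\<bar>)))"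
proof -
  define c where "c = g\<^sup>2 * \<mu> / (\<omega> - \<Omega>)"
  define e where "e = (\<lambda>b x. exp (- k * \<bar>x - b\<bar>))"
  define e' where "e' = (\<lambda>b x. - k * sgn (x - b) * exp (- k * \<bar>x - b\<bar>))"
  define \<phi> where "\<phi> = (\<lambda>x. e d x + s * e (-d) x)"
  define \<phi>' where "\<phi>' = (\<lambda>x. e' d x + s * e' (-d) x)"
  define z where "z = exp (- 2 * k * d)"
  have E: "x \<noteq> b \<Longrightarrow> (e b has_real_derivative e' b x) (at x)"
    "x \<noteq> b \<Longrightarrow> (e' b has_real_derivative k\<^sup>2 * e b x) (at x)"
    "(e b has_real_derivative - k) (at_right b)" "(e b has_real_derivative k) (at_left b)" for b x
    unfolding e_def e'_def by (fact exp_abs_derivs)+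
  have vals: "e b b = 1" "e d (-d) = z" "e (-d) d = z" "e' d (-d) = k * z" "e' (-d) d = - k * z" for b
    using d by (simp_all add: e_def e'_def z_def)
  have z: "0 < z" "z < 1" using k d by (simp_all add: z_def)
  have "\<phi> d \<noteq> 0" using s z by (auto simp: \<phi>_def vals)
  have der: "(\<phi> has_real_derivative \<phi>' x) (at x)" "(\<phi>' has_real_derivative k\<^sup>2 * \<phi> x) (at x)"
    if "x \<noteq> d" "x \<noteq> - d" for x
  proof -
    show "(\<phi> has_real_derivative \<phi>' x) (at x)"
      unfolding \<phi>_def \<phi>'_def using that by (intro DERIV_add DERIV_cmult E(1))
    have "(\<phi>' has_real_derivative k\<^sup>2 * e d x + s * (k\<^sup>2 * e (-d) x)) (at x)"
      unfolding \<phi>'_def using that by (intro DERIV_add DERIV_cmult E(2))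
    thus "(\<phi>' has_real_derivative k\<^sup>2 * \<phi> x) (at x)" by (simp add: \<phi>_def algebra_simps)
  qed
  have w: "(f has_real_derivative D) (at x) \<Longrightarrow> (f has_real_derivative D) (at x within A)"
    for f D x A by (rule has_field_derivative_at_within)
  have ne: "d \<noteq> - d" "- d \<noteq> d" using d by auto
  have side: "(\<phi> has_real_derivative - k + s * (- k * z)) (at_right d)"
    "(\<phi> has_real_derivative k + s * (- k * z)) (at_left d)"
    "(\<phi> has_real_derivative k * z + s * (- k)) (at_right (-d))"
    "(\<phi> has_real_derivative k * z + s * k) (at_left (-d))"
    unfolding \<phi>_def
    by (intro DERIV_add DERIV_cmult E(3,4) w[OF E(1)[OF ne(1)], unfolded vals]
        w[OF E(1)[OF ne(2)], unfolded vals])+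
  have c1: "2 * k + c * (1 + s * z) = 0" using cond by (simp add: c_def z_def)
  have jump: "- (- k + s * (- k * z)) + (k + s * (- k * z)) + c * \<phi> d = 0"
    "- (k * z + s * (- k)) + (k * z + s * k) + c * \<phi> (-d) = 0"
    using c1 s by (auto simp: \<phi>_def vals algebra_simps)
  have cont: "continuous_on UNIV \<phi>" unfolding \<phi>_def e_def by (intro continuous_intros)
  have "integrable lborel (\<lambda>x. (\<phi> x)\<^sup>2)"
  proof (rule Bochner_Integration.integrable_bound)
    show "integrable lborel (\<lambda>x. 2 * exp (- (2 * k) * \<bar>x - d\<bar>) + 2 * exp (- (2 * k) * \<bar>x - - d\<bar>))"
      using k by (intro Bochner_Integration.integrable_add integrable_mult_right integrable_exp_minus_abs) auto
    show "(\<lambda>x. (\<phi> x)\<^sup>2) \<in> borel_measurable lborel"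
      using cont by (intro borel_measurable_power) (simp add: borel_measurable_continuous_onI)
    have "(\<phi> x)\<^sup>2 \<le> 2 * exp (- (2 * k) * \<bar>x - d\<bar>) + 2 * exp (- (2 * k) * \<bar>x - - d\<bar>)" for x
    proof -
      have sq: "(e b x)\<^sup>2 = exp (- (2 * k) * \<bar>x - b\<bar>)" for b
        by (simp add: e_def power2_eq_square flip: exp_add)
      have "(u + s * v)\<^sup>2 \<le> 2 * u\<^sup>2 + 2 * v\<^sup>2" for u v :: real
        using s zero_le_power2[of "u - s * v"] by (auto simp: power2_eq_square algebra_simps)
      thus ?thesis unfolding \<phi>_def sq[symmetric] .
    qed
    thus "AE x in lborel. norm ((\<phi> x)\<^sup>2) \<le>
        norm (2 * exp (- (2 * k) * \<bar>x - d\<bar>) + 2 * exp (- (2 * k) * \<bar>x - - d\<bar>))"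
      by (intro AE_I2) (simp add: add_nonneg_nonneg)
  qed
  hence sqi: "square_integrable (\<lambda>x. complex_of_real (\<phi> x))"
    unfolding square_integrable_def
    using cont by (auto simp: borel_measurable_continuous_onI intro!: borel_measurable_of_real)
  have "bound_state g \<Omega> \<rho> d \<mu> \<omega> (\<lambda>x. complex_of_real (\<phi> x))"
    unfolding bound_state_def c_def[symmetric]
  proof (intro conjI)
    show "\<exists>x. complex_of_real (\<phi> x) \<noteq> 0" using \<open>\<phi> d \<noteq> 0\<close> by auto
    show "continuous_on UNIV (\<lambda>x. complex_of_real (\<phi> x))" using cont by (intro continuous_intros)
    show "\<exists>\<psi>' \<psi>''. \<forall>x\<in>UNIV - {- d, d}.
        ((\<lambda>x. complex_of_real (\<phi> x)) has_vector_derivative \<psi>' x) (at x) \<and>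
        (\<psi>' has_vector_derivative \<psi>'' x) (at x) \<and>
        - \<psi>'' x = lam g \<Omega> \<rho> \<omega> *\<^sub>R complex_of_real (\<phi> x)"
    proof (rule exI[of _ "\<lambda>x. complex_of_real (\<phi>' x)"], rule exI[of _ "\<lambda>x. complex_of_real (k\<^sup>2 * \<phi> x)"],
        intro ballI conjI)
      fix x assume "x \<in> UNIV - {- d, d}"
      hence x: "x \<noteq> d" "x \<noteq> - d" by auto
      show "((\<lambda>x. complex_of_real (\<phi> x)) has_vector_derivative complex_of_real (\<phi>' x)) (at x)"
        "((\<lambda>x. complex_of_real (\<phi>' x)) has_vector_derivative complex_of_real (k\<^sup>2 * \<phi> x)) (at x)"
        using der[OF x] by (auto intro: has_vector_derivative_of_real simp del: of_real_mult)
    qed (simp add: k(2) scaleR_conv_of_real)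
    have "\<exists>p q. ((\<lambda>x. complex_of_real (\<phi> x)) has_vector_derivative p) (at_right a) \<and>
        ((\<lambda>x. complex_of_real (\<phi> x)) has_vector_derivative q) (at_left a) \<and>
        - p + q + c *\<^sub>R complex_of_real (\<phi> a) = 0"
      if "(\<phi> has_real_derivative p) (at_right a)" "(\<phi> has_real_derivative q) (at_left a)"
        "- p + q + c * \<phi> a = 0" for a p q
    proof (intro exI conjI)
      show "((\<lambda>x. complex_of_real (\<phi> x)) has_vector_derivative of_real p) (at_right a)"
        "((\<lambda>x. complex_of_real (\<phi> x)) has_vector_derivative of_real q) (at_left a)"
        using that by (auto intro: has_vector_derivative_of_real)
      have "complex_of_real (- p + q + c * \<phi> a) = 0" using that by simp
      thus "- complex_of_real p + of_real q + c *\<^sub>R complex_of_real (\<phi> a) = 0"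
        by (simp add: scaleR_conv_of_real)
    qed
    from this[OF side(1,2) jump(1)] this[OF side(3,4) jump(2)]
    show "\<forall>a\<in>{- d, d}. \<exists>p q.
        ((\<lambda>x. complex_of_real (\<phi> x)) has_vector_derivative p) (at_right a) \<and>
        ((\<lambda>x. complex_of_real (\<phi> x)) has_vector_derivative q) (at_left a) \<and>
        - p + q + c *\<^sub>R complex_of_real (\<phi> a) = 0" by blast
  qed (fact sqi)
  thus ?thesis by (simp add: \<phi>_def e_def)
qed

section \<open>Reduction of complex bound states to real ones\<close>

text \<open>All conditions are linear with real coefficients, so they pass to real and imaginary
  parts, and the modulus dominates both. Nontriviality is assumed since one of the parts may
  vanish.\<close>

lemma real_bound_state_component:
  assumes \<psi>: "bound_state g \<Omega> \<rho> d \<mu> \<omega> \<psi>" and h: "h = Re \<or> h = Im" and nz: "\<exists>x. h (\<psi> x) \<noteq> 0"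
  shows "real_bound_state (lam g \<Omega> \<rho> \<omega>) (g\<^sup>2 * \<mu> / (\<omega> - \<Omega>)) d (\<lambda>x. h (\<psi> x))"
proof -
  define c where "c = g\<^sup>2 * \<mu> / (\<omega> - \<Omega>)"
  have bl: "bounded_linear h" using h bounded_linear_Re bounded_linear_Im by auto
  have hder: "((\<lambda>x. h (f x)) has_real_derivative h D) F" if "(f has_vector_derivative D) F" for f D F
    using bounded_linear.has_vector_derivative[OF bl that]
    by (simp add: has_real_derivative_iff_has_vector_derivative)
  have lin: "h (u + v) = h u + h v" "h (- u) = - h u" "h (r *\<^sub>R u) = r * h u" "h 0 = 0" for u v r
    using h by auto
  obtain \<psi>' \<psi>'' where der: "\<And>x. x \<in> UNIV - {-d, d} \<Longrightarrow> (\<psi> has_vector_derivative \<psi>' x) (at x) \<and>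
        (\<psi>' has_vector_derivative \<psi>'' x) (at x) \<and> - \<psi>'' x = lam g \<Omega> \<rho> \<omega> *\<^sub>R \<psi> x"
    using \<psi> unfolding bound_state_def by blast
  have meas: "\<psi> \<in> borel_measurable lborel" and int: "integrable lborel (\<lambda>x. (cmod (\<psi> x))\<^sup>2)"
    using \<psi> unfolding bound_state_def square_integrable_def by auto
  have "integrable lborel (\<lambda>x. (h (\<psi> x))\<^sup>2)"
  proof (rule Bochner_Integration.integrable_bound[OF int])
    show "(\<lambda>x. (h (\<psi> x))\<^sup>2) \<in> borel_measurable lborel"
      using h meas by auto
    have "(h u)\<^sup>2 \<le> (cmod u)\<^sup>2" for u using h by (auto simp: cmod_power2)
    thus "AE x in lborel. norm ((h (\<psi> x))\<^sup>2) \<le> norm ((cmod (\<psi> x))\<^sup>2)" by simp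
  qed
  moreover have "\<exists>\<phi>'. \<forall>x\<in>UNIV - {-d, d}. ((\<lambda>x. h (\<psi> x)) has_real_derivative \<phi>' x) (at x) \<and>
        (\<phi>' has_real_derivative - lam g \<Omega> \<rho> \<omega> * h (\<psi> x)) (at x)"
  proof (intro exI[of _ "\<lambda>x. h (\<psi>' x)"] ballI conjI)
    fix x assume "x \<in> UNIV - {-d, d}"
    note D = der[OF this]
    show "((\<lambda>x. h (\<psi> x)) has_real_derivative h (\<psi>' x)) (at x)" using D hder by blast
    have "- h (\<psi>'' x) = lam g \<Omega> \<rho> \<omega> * h (\<psi> x)" using D lin(2,3) by metis
    hence "h (\<psi>'' x) = - lam g \<Omega> \<rho> \<omega> * h (\<psi> x)" by simp
    moreover have "((\<lambda>x. h (\<psi>' x)) has_real_derivative h (\<psi>'' x)) (at x)" using D hder by blast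
    ultimately show "((\<lambda>x. h (\<psi>' x)) has_real_derivative - lam g \<Omega> \<rho> \<omega> * h (\<psi> x)) (at x)" by simp
  qed
  moreover have "\<forall>a\<in>{-d, d}. \<exists>p q. ((\<lambda>x. h (\<psi> x)) has_real_derivative p) (at_right a) \<and>
        ((\<lambda>x. h (\<psi> x)) has_real_derivative q) (at_left a) \<and> - p + q + c * h (\<psi> a) = 0"
  proof
    fix a assume "a \<in> {-d, d}"
    then obtain p q where "(\<psi> has_vector_derivative p) (at_right a)"
      "(\<psi> has_vector_derivative q) (at_left a)" and j: "- p + q + c *\<^sub>R \<psi> a = 0"
      using \<psi> unfolding bound_state_def c_def by blast
    moreover have "- h p + h q + c * h (\<psi> a) = 0"
      using arg_cong[OF j, of h] by (simp only: lin)
    ultimately show "\<exists>p q. ((\<lambda>x. h (\<psi> x)) has_real_derivative p) (at_right a) \<and>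
        ((\<lambda>x. h (\<psi> x)) has_real_derivative q) (at_left a) \<and> - p + q + c * h (\<psi> a) = 0"
      using hder by blast
  qed
  ultimately show ?thesis using nz unfolding real_bound_state_def c_def by blast
qed

text \<open>A nonzero component has a nonzero value at \<open>d\<close> or \<open>-d\<close>, so its
  values there cannot be both equal and opposite. At least one secular equation follows, and parity
  determines which.\<close>

lemma bound_state_conditions:
  assumes \<psi>: "bound_state g \<Omega> \<rho> d \<mu> \<omega> \<psi>" and d: "d > 0"
  defines "k \<equiv> sqrt (- lam g \<Omega> \<rho> \<omega>)" and "c \<equiv> g\<^sup>2 * \<mu> / (\<omega> - \<Omega>)"
  shows "lam g \<Omega> \<rho> \<omega> < 0"
    and "2 * k + c * (1 + exp (- 2 * k * d)) = 0 \<or> 2 * k + c * (1 - exp (- 2 * k * d)) = 0"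
    and "(\<And>x. \<psi> (- x) = \<psi> x) \<Longrightarrow> 2 * k + c * (1 + exp (- 2 * k * d)) = 0"
    and "(\<And>x. \<psi> (- x) = - \<psi> x) \<Longrightarrow> 2 * k + c * (1 - exp (- 2 * k * d)) = 0"
proof -
  obtain h where h: "h = Re \<or> h = Im" "\<exists>x. h (\<psi> x) \<noteq> 0"
    using \<psi> unfolding bound_state_def complex_eq_iff by (metis zero_complex.sel)
  note R = real_bound_state_conditions[OF real_bound_state_component[OF \<psi> h] d, folded k_def c_def]
  show "lam g \<Omega> \<rho> \<omega> < 0" by (rule R(1))
  show "2 * k + c * (1 + exp (- 2 * k * d)) = 0 \<or> 2 * k + c * (1 - exp (- 2 * k * d)) = 0"
    using R(2-4) by fastforce
  show "2 * k + c * (1 + exp (- 2 * k * d)) = 0" if "\<And>x. \<psi> (- x) = \<psi> x"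
    using R(2,4) that[of d] by fastforce
  show "2 * k + c * (1 - exp (- 2 * k * d)) = 0" if "\<And>x. \<psi> (- x) = - \<psi> x"
    using R(2,3) that[of d] h(1) by fastforce
qed

section \<open>The even and odd level functions\<close>

text \<open>The strength \<open>\<mu>\<close> is kept out of the parameters, since it varies in the
  statement about sufficiently negative strengths.\<close>

locale two_delta =
  fixes g \<Omega> \<rho> d :: real
  assumes g_pos: "g > 0" and Omega_pos: "\<Omega> > 0" and rho_pos: "\<rho> > 0" and d_pos: "d > 0"
begin

abbreviation "wm \<equiv> omega_minus g \<Omega> \<rho>"
abbreviation "wp \<equiv> omega_plus g \<Omega> \<rho>"
abbreviation "\<Lambda> \<equiv> lam g \<Omega> \<rho>"
abbreviation "\<kappa> \<equiv> kappa g \<Omega> \<rho>"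

lemma P_pos: "g\<^sup>2 * \<rho> > 0"
  using g_pos rho_pos by simp

text \<open>Vieta's relations for
  \<open>\<omega> * (\<omega> - \<Omega>) - g\<^sup>2 * \<rho>\<close>, together with the position
  of its roots relative to 0 and the pole \<open>\<Omega>\<close>.\<close>

lemma roots: "wm + wp = \<Omega>" "wm * wp = - (g\<^sup>2 * \<rho>)" "wm < 0" "\<Omega> < wp"
proof -
  let ?D = "\<Omega>\<^sup>2 + 4 * g\<^sup>2 * \<rho>"
  have D: "?D > \<Omega>\<^sup>2" using P_pos by (simp add: mult.assoc)
  hence s: "sqrt ?D > \<Omega>" using Omega_pos by (intro real_less_rsqrt)
  define S where "S = sqrt ?D"
  have w: "wm = (\<Omega> - S) / 2" "wp = (\<Omega> + S) / 2" by (simp_all add: omega_minus_def omega_plus_def S_def)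
  have S2: "S\<^sup>2 = ?D" unfolding S_def
    using D zero_le_power2[of \<Omega>] by (intro real_sqrt_pow2) linarith
  have "wm * wp = (\<Omega>\<^sup>2 - S\<^sup>2) / 4" unfolding w by (simp add: power2_eq_square algebra_simps)
  thus "wm * wp = - (g\<^sup>2 * \<rho>)" unfolding S2 by simp
  show "wm + wp = \<Omega>" "wm < 0" "\<Omega> < wp"
    using s unfolding w S_def[symmetric] by (simp_all add: field_simps)
qed

lemma lam_factor:
  assumes "\<omega> \<noteq> \<Omega>"
  shows "\<Lambda> \<omega> = (\<omega> - wm) * (\<omega> - wp) / (\<omega> - \<Omega>)"
proof -
  have "(\<omega> - wm) * (\<omega> - wp) = \<omega> * (\<omega> - \<Omega>) - g\<^sup>2 * \<rho>"
  proof -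
    have "(\<omega> - wm) * (\<omega> - wp) = \<omega> * \<omega> - \<omega> * (wm + wp) + wm * wp" by (simp add: algebra_simps)
    thus ?thesis unfolding roots(1,2) by (simp add: algebra_simps)
  qed
  thus ?thesis using assms by (simp add: lam_def field_simps)
qed

text \<open>On each side of the pole only one of the two root factors can change sign.\<close>

lemma lam_neg_iff:
  assumes "\<omega> \<noteq> \<Omega>"
  shows "\<Lambda> \<omega> < 0 \<longleftrightarrow> \<omega> \<in> G_minus g \<Omega> \<rho> \<union> G_plus g \<Omega> \<rho>"
proof (cases "\<omega> < \<Omega>")
  case True
  hence "\<omega> - \<Omega> < 0" "\<omega> - wp < 0" using roots(4) by auto
  thus ?thesis using True
    by (simp add: lam_factor[OF assms] G_minus_def G_plus_def divide_less_0_iff zero_less_mult_iff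
        mult_less_0_iff)
next
  case False
  hence "\<omega> - \<Omega> > 0" "\<omega> - wm > 0" using assms roots(3) Omega_pos by auto
  thus ?thesis
    by (simp add: lam_factor[OF assms] G_minus_def G_plus_def divide_less_0_iff zero_less_mult_iff
        mult_less_0_iff)
qed

text \<open>The second assumption puts both points on the same side of the pole, so
  \<open>(x - \<Omega>) * (y - \<Omega>)\<close> is positive.\<close>

lemma lam_strict_mono:
  assumes "x < y" "y < \<Omega> \<or> \<Omega> < x"
  shows "\<Lambda> x < \<Lambda> y"
proof -
  have "\<Lambda> y - \<Lambda> x = (y - x) + g\<^sup>2 * \<rho> * ((y - x) / ((x - \<Omega>) * (y - \<Omega>)))"
  proof -
    have "(x - \<Omega>) * (y - \<Omega>) \<noteq> 0" "x - \<Omega> \<noteq> 0" "y - \<Omega> \<noteq> 0" using assms by auto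
    hence "1 / (x - \<Omega>) - 1 / (y - \<Omega>) = (y - x) / ((x - \<Omega>) * (y - \<Omega>))"
      by (simp add: diff_frac_eq)
    hence "g\<^sup>2 * \<rho> * ((y - x) / ((x - \<Omega>) * (y - \<Omega>))) = g\<^sup>2 * \<rho> * (1 / (x - \<Omega>) - 1 / (y - \<Omega>))"
      by (simp only:)
    thus ?thesis by (simp add: lam_def right_diff_distrib)
  qed
  moreover have "(x - \<Omega>) * (y - \<Omega>) > 0"
    using assms by (auto intro: mult_neg_neg)
  hence "g\<^sup>2 * \<rho> * ((y - x) / ((x - \<Omega>) * (y - \<Omega>))) > 0"
    using P_pos assms(1) by (metis mult_pos_pos divide_pos_pos diff_gt_0_iff_gt)
  ultimately show ?thesis using assms(1) by linarith
qed

lemma kappa_pos: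
  assumes "\<omega> < wm \<or> \<Omega> < \<omega> \<and> \<omega> < wp"
  shows "\<Lambda> \<omega> < 0" "\<kappa> \<omega> > 0" "(\<kappa> \<omega>)\<^sup>2 = - \<Lambda> \<omega>"
proof -
  have "\<omega> \<noteq> \<Omega>" using assms roots Omega_pos by auto
  thus l: "\<Lambda> \<omega> < 0" using lam_neg_iff assms by (auto simp: G_minus_def G_plus_def)
  thus "\<kappa> \<omega> > 0" "(\<kappa> \<omega>)\<^sup>2 = - \<Lambda> \<omega>" by (simp_all add: kappa_def)
qed

lemma kappa_strict_antimono:
  assumes "x < y" "y < wm \<or> \<Omega> < x"
  shows "\<kappa> y < \<kappa> x"
proof -
  have "y < \<Omega> \<or> \<Omega> < x" using assms(2) roots(3) Omega_pos by linarith
  from lam_strict_mono[OF assms(1) this] show ?thesis by (simp add: kappa_def)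
qed

lemma lam_deriv:
  assumes "\<omega> \<noteq> \<Omega>"
  shows "(\<Lambda> has_real_derivative 1 + g\<^sup>2 * \<rho> / (\<omega> - \<Omega>)\<^sup>2) (at \<omega>)"
proof -
  have "(\<Lambda> has_real_derivative
      1 - (0 * (\<omega> - \<Omega>) - g\<^sup>2 * \<rho> * (1 - 0)) / ((\<omega> - \<Omega>) * (\<omega> - \<Omega>))) (at \<omega>)"
    unfolding lam_def[abs_def] using assms
    by (intro DERIV_diff DERIV_divide DERIV_const DERIV_ident) simp
  thus ?thesis by (simp add: power2_eq_square)
qed

lemma kappa_deriv:
  assumes "\<omega> < wm \<or> \<Omega> < \<omega> \<and> \<omega> < wp"
  shows "(\<kappa> has_real_derivative - (1 + g\<^sup>2 * \<rho> / (\<omega> - \<Omega>)\<^sup>2) / (2 * \<kappa> \<omega>)) (at \<omega>)"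
proof -
  have "\<omega> \<noteq> \<Omega>" using assms roots Omega_pos by auto
  from DERIV_chain2[OF DERIV_real_sqrt DERIV_minus[OF lam_deriv[OF this]]]
  show ?thesis using kappa_pos[OF assms] unfolding kappa_def[abs_def] by (simp add: field_simps)
qed

lemma lam_isCont: "\<omega> \<noteq> \<Omega> \<Longrightarrow> isCont \<Lambda> \<omega>"
  using lam_deriv by (rule DERIV_isCont)

lemma lam_roots: "\<Lambda> wm = 0" "\<Lambda> wp = 0"
proof -
  have "wm \<noteq> \<Omega>" "wp \<noteq> \<Omega>" using roots(3,4) Omega_pos by auto
  thus "\<Lambda> wm = 0" "\<Lambda> wp = 0" by (simp_all add: lam_factor)
qed

lemma kappa_tendsto_0:
  "filterlim \<kappa> (at_right 0) (at_left wm)" "filterlim \<kappa> (at_right 0) (at_left wp)"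
proof -
  have c: "(\<kappa> \<longlongrightarrow> 0) (at_left w)" if "\<Lambda> w = 0" "w \<noteq> \<Omega>" for w
  proof -
    have "((\<lambda>x. sqrt (- \<Lambda> x)) \<longlongrightarrow> sqrt (- \<Lambda> w)) (at_left w)"
      using tendsto_within_subset[OF lam_isCont[OF that(2), unfolded isCont_def] subset_UNIV]
      by (intro tendsto_real_sqrt tendsto_minus)
    thus ?thesis using that by (simp add: kappa_def[abs_def])
  qed
  have pos: "eventually (\<lambda>x. \<kappa> x > 0) (at_left wm)" "eventually (\<lambda>x. \<kappa> x > 0) (at_left wp)"
    using eventually_at_left_real[of "wm - 1" wm] eventually_at_left_real[of \<Omega> wp] roots
    by (auto elim!: eventually_mono intro: kappa_pos)
  have "wm \<noteq> \<Omega>" "wp \<noteq> \<Omega>" using roots Omega_pos by auto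
  with c lam_roots pos show "filterlim \<kappa> (at_right 0) (at_left wm)" "filterlim \<kappa> (at_right 0) (at_left wp)"
    by (auto intro!: tendsto_imp_filterlim_at_right)
qed

lemma kappa_at_top:
  "filterlim \<kappa> at_top at_bot" "filterlim \<kappa> at_top (at_right \<Omega>)"
proof -
  define p where "p = g\<^sup>2 * \<rho>"
  have p: "p > 0" using P_pos by (simp add: p_def)
  have "filterlim (\<lambda>x. - \<Lambda> x) at_top at_bot" "filterlim (\<lambda>x. - \<Lambda> x) at_top (at_right \<Omega>)"
    unfolding lam_def p_def[symmetric] using p by real_asymp+
  thus "filterlim \<kappa> at_top at_bot" "filterlim \<kappa> at_top (at_right \<Omega>)"
    unfolding kappa_def[abs_def] by (auto intro: filterlim_compose[OF sqrt_at_top])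
qed

section \<open>One level function for both parities, and its behaviour on the lower interval\<close>

definition F :: "real \<Rightarrow> real \<Rightarrow> real" where
  "F s \<omega> = 2 / g\<^sup>2 * ((\<Omega> - \<omega>) * profile s d (\<kappa> \<omega>))"

lemma f_eq_F: "f_e g \<Omega> \<rho> d = F 1" "f_o g \<Omega> \<rho> d = F (-1)"
  by (rule ext, simp add: F_def f_e_def f_o_def profile_def mult_ac)+

lemma profile_kappa_pos:
  assumes "s = 1 \<or> s = -1" "\<omega> < wm \<or> \<Omega> < \<omega> \<and> \<omega> < wp"
  shows "profile s d (\<kappa> \<omega>) > 0"
  using profile_pos(1)[OF assms(1) d_pos kappa_pos(2)[OF assms(2)]] .

lemma F_pos:
  assumes "s = 1 \<or> s = -1" "\<omega> < wm"
  shows "F s \<omega> > 0"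
proof -
  have "\<Omega> - \<omega> > 0" using assms(2) roots(3) Omega_pos by linarith
  moreover have "profile s d (\<kappa> \<omega>) > 0" using assms profile_kappa_pos by simp
  ultimately show ?thesis unfolding F_def using g_pos by (intro mult_pos_pos divide_pos_pos) auto
qed

lemma F_neg:
  assumes "s = 1 \<or> s = -1" "\<Omega> < \<omega>" "\<omega> < wp"
  shows "F s \<omega> < 0"
proof -
  have "(\<Omega> - \<omega>) * profile s d (\<kappa> \<omega>) < 0"
    using profile_kappa_pos[of s \<omega>] assms by (intro mult_neg_pos) auto
  moreover have "2 / g\<^sup>2 > 0" using g_pos by simp
  ultimately show ?thesis unfolding F_def by (metis mult_pos_neg)
qed

lemma F_isCont:
  assumes s: "s = 1 \<or> s = -1" and w: "\<omega> < wm \<or> \<Omega> < \<omega> \<and> \<omega> < wp"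
  shows "isCont (F s) \<omega>"
proof -
  have "isCont (\<lambda>\<omega>. profile s d (\<kappa> \<omega>)) \<omega>"
    by (rule isCont_o2[OF DERIV_isCont[OF kappa_deriv[OF w]]
          DERIV_isCont[OF profile_deriv[OF s d_pos kappa_pos(2)[OF w]]]])
  thus ?thesis unfolding F_def[abs_def]
    by (intro isCont_mult isCont_diff continuous_const continuous_ident)
qed

lemma F_minus_antimono:
  assumes s: "s = 1 \<or> s = -1" and "x < y" "y < wm"
  shows "F s y < F s x"
proof -
  have "profile s d (\<kappa> y) < profile s d (\<kappa> x)"
    using assms kappa_pos[of y] kappa_strict_antimono[of x y] d_pos by (intro profile_strict_mono) auto
  moreover have "profile s d (\<kappa> y) > 0" using profile_kappa_pos assms by simp
  ultimately have "(\<Omega> - y) * profile s d (\<kappa> y) < (\<Omega> - x) * profile s d (\<kappa> x)"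
    using assms roots Omega_pos by (intro mult_strict_mono) auto
  thus ?thesis using g_pos by (simp add: F_def divide_strict_right_mono)
qed

lemma F_minus_at_top:
  assumes s: "s = 1 \<or> s = -1"
  shows "filterlim (F s) at_top at_bot"
proof -
  have "filterlim (\<lambda>w. \<Omega> - w) at_top at_bot" by real_asymp
  moreover have "filterlim (\<lambda>w. profile s d (\<kappa> w)) at_top at_bot"
    using profile_limits(3)[OF d_pos s] kappa_at_top(1) by (rule filterlim_compose)
  ultimately have "filterlim (\<lambda>w. (\<Omega> - w) * profile s d (\<kappa> w)) at_top at_bot"
    by (rule filterlim_at_top_mult_at_top)
  thus ?thesis unfolding F_def[abs_def]
    using g_pos by (intro filterlim_tendsto_pos_mult_at_top[OF tendsto_const]) auto
qed

text \<open>At \<open>wm\<close> the decay rate tends to 0 from the right, so the profile limits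
  apply; in the odd case the result is \<open>(\<Omega> - wm) / (g\<^sup>2 * d)\<close>.\<close>

lemma F_minus_limits:
  "(F 1 \<longlongrightarrow> 0) (at_left wm)" "(F (-1) \<longlongrightarrow> mu_L g \<Omega> \<rho> d) (at_left wm)"
proof -
  have "(F s \<longlongrightarrow> 2 / g\<^sup>2 * ((\<Omega> - wm) * c)) (at_left wm)"
    if "(profile s d \<longlongrightarrow> c) (at_right 0)" for s c
    unfolding F_def[abs_def]
    by (intro tendsto_intros filterlim_compose[OF that kappa_tendsto_0(1)])
  moreover have mu: "2 / g\<^sup>2 * ((\<Omega> - wm) * (1 / (2 * d))) = mu_L g \<Omega> \<rho> d"
  proof -
    have "\<Omega> - wm = (\<Omega> + sqrt (\<Omega>\<^sup>2 + 4 * g\<^sup>2 * \<rho>)) / 2"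
      by (simp add: omega_minus_def diff_divide_distrib add_divide_distrib)
    thus ?thesis by (simp only: mu_L_def times_divide_times_eq times_divide_eq_right mult_1_right
      times_divide_eq_left divide_divide_eq_left mult_ac)
  qed
  note lim = calculation
  from lim[OF profile_limits(1)[OF d_pos]] lim[OF profile_limits(2)[OF d_pos]]
  show "(F 1 \<longlongrightarrow> 0) (at_left wm)" "(F (-1) \<longlongrightarrow> mu_L g \<Omega> \<rho> d) (at_left wm)"
    by (simp_all only: mult_zero_right mu)
qed

text \<open>The strict third claim also rules out odd states at the threshold \<open>mu_L\<close>
  itself.\<close>

lemma F_minus_level:
  "\<mu> > 0 \<Longrightarrow> \<exists>!\<omega>. \<omega> < wm \<and> F 1 \<omega> = \<mu>"
  "\<mu> > mu_L g \<Omega> \<rho> d \<Longrightarrow> \<exists>!\<omega>. \<omega> < wm \<and> F (-1) \<omega> = \<mu>"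
  "\<omega> < wm \<Longrightarrow> F (-1) \<omega> > mu_L g \<Omega> \<rho> d"
proof -
  have c: "continuous_on {..<wm} (F s)" if "s = 1 \<or> s = -1" for s
    using F_isCont[OF that] by (intro continuous_at_imp_continuous_on) auto
  show "\<mu> > 0 \<Longrightarrow> \<exists>!\<omega>. \<omega> < wm \<and> F 1 \<omega> = \<mu>"
    using c[of 1] F_minus_antimono[of 1] F_minus_at_top[of 1] F_minus_limits(1)
    by (rule ex1_level_strict_antimono_halfline(1)[of wm "F 1" 0]) auto
  show "\<mu> > mu_L g \<Omega> \<rho> d \<Longrightarrow> \<exists>!\<omega>. \<omega> < wm \<and> F (-1) \<omega> = \<mu>"
    using c[of "-1"] F_minus_antimono[of "-1"] F_minus_at_top[of "-1"] F_minus_limits(2)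
    by (rule ex1_level_strict_antimono_halfline(1)[of wm "F (-1)" "mu_L g \<Omega> \<rho> d"]) auto
  show "\<omega> < wm \<Longrightarrow> F (-1) \<omega> > mu_L g \<Omega> \<rho> d"
    using c[of "-1"] F_minus_antimono[of "-1"] F_minus_at_top[of "-1"] F_minus_limits(2)
    by (rule ex1_level_strict_antimono_halfline(2)[of wm "F (-1)"]) auto
qed

section \<open>Unimodality and minima on the upper interval\<close>

text \<open>With \<open>k = \<kappa> \<omega>\<close> and \<open>(\<Omega> - \<omega>) * k' =
  (k\<^sup>2 + 2 * \<omega> - \<Omega>) / (2 * k)\<close>, the product rule lets a positive factor
  be taken out. What remains contains \<open>k\<^sup>2 * (2 - l) / l\<close>, which is
  \<open>critN s x\<close> rescaled by \<open>(2 * d)\<^sup>2\<close>.\<close>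

lemma F_plus_deriv:
  assumes s: "s = 1 \<or> s = -1" and w: "\<Omega> < \<omega>" "\<omega> < wp"
  defines "x \<equiv> 2 * d * \<kappa> \<omega>"
  defines "l \<equiv> (exp x + s * (1 + x)) / (exp x + s)"
  shows "(F s has_real_derivative
      2 / g\<^sup>2 * (profile s d (\<kappa> \<omega>) * l / (2 * (\<kappa> \<omega>)\<^sup>2)) *
      (2 * \<omega> - \<Omega> - critN s x / (2 * d)\<^sup>2)) (at \<omega>)"
    and "2 / g\<^sup>2 * (profile s d (\<kappa> \<omega>) * l / (2 * (\<kappa> \<omega>)\<^sup>2)) > 0"
proof -
  define k where "k = \<kappa> \<omega>"
  define h where "h = profile s d k"
  have w': "\<omega> < wm \<or> \<Omega> < \<omega> \<and> \<omega> < wp" using w by simp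
  have k: "k > 0" "k\<^sup>2 = - \<Lambda> \<omega>" using kappa_pos[OF w'] by (auto simp: k_def)
  have x: "x > 0" "x = 2 * d * k" using k d_pos by (auto simp: x_def k_def)
  note p = exp_sign_inequalities[OF x(1) s]
  have l: "l > 0" using p by (simp add: l_def)
  have h: "h > 0" using profile_kappa_pos[OF s w'] by (simp add: h_def k_def)
  show "2 / g\<^sup>2 * (profile s d (\<kappa> \<omega>) * l / (2 * (\<kappa> \<omega>)\<^sup>2)) > 0"
    using h l k(1) g_pos unfolding h_def k_def by (intro mult_pos_pos divide_pos_pos) auto
  define k' where "k' = - (1 + g\<^sup>2 * \<rho> / (\<omega> - \<Omega>)\<^sup>2) / (2 * k)"
  have "((\<lambda>\<omega>. profile s d (\<kappa> \<omega>)) has_real_derivative h / k * l * k') (at \<omega>)"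
    using DERIV_chain2[OF profile_deriv[OF s d_pos] kappa_deriv[OF w']] k
    by (simp add: h_def k_def l_def x_def k'_def)
  moreover have alg: "(0 - 1) * p + q * (\<Omega> - \<omega>) = (\<Omega> - \<omega>) * q - p" for p q :: real
    by (simp add: algebra_simps)
  ultimately have "(F s has_real_derivative 2 / g\<^sup>2 * ((\<Omega> - \<omega>) * (h / k * l * k') - h)) (at \<omega>)"
    unfolding F_def[abs_def] h_def k_def
    by (intro DERIV_cmult, rule DERIV_cong[OF DERIV_mult[OF DERIV_diff[OF DERIV_const DERIV_ident]]])
  also have "(\<Omega> - \<omega>) * (h / k * l * k') - h
      = h * l / (2 * k\<^sup>2) * (2 * \<omega> - \<Omega> - critN s x / (2 * d)\<^sup>2)"
  proof -
    have "(\<Omega> - \<omega>) * k' = ((\<omega> - \<Omega>) + g\<^sup>2 * \<rho> / (\<omega> - \<Omega>)) / (2 * k)"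
    proof -
      define a where "a = \<omega> - \<Omega>"
      have a: "a > 0" "\<Omega> - \<omega> = - a" using w by (auto simp: a_def)
      have "a * (1 + g\<^sup>2 * \<rho> / a\<^sup>2) = a + g\<^sup>2 * \<rho> / a"
        using a by (simp add: distrib_left power2_eq_square)
      hence "(- a) * (- (1 + g\<^sup>2 * \<rho> / a\<^sup>2) / (2 * k)) = (a + g\<^sup>2 * \<rho> / a) / (2 * k)"
        by (simp only: minus_mult_minus times_divide_eq_right minus_divide_left[symmetric])
      thus ?thesis unfolding k'_def a_def[symmetric] a(2) .
    qed
    also have "g\<^sup>2 * \<rho> / (\<omega> - \<Omega>) = k\<^sup>2 + \<omega>" using k(2) by (simp add: lam_def)
    finally have 1: "(\<Omega> - \<omega>) * k' = (k\<^sup>2 + 2 * \<omega> - \<Omega>) / (2 * k)" by (simp add: algebra_simps)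
    have "critN s x / (2 * d)\<^sup>2 = k\<^sup>2 * ((exp x + s * (1 - x)) / (exp x + s * (1 + x)))"
      using d_pos unfolding critN_def x(2) by (simp add: power_mult_distrib)
    also have "(exp x + s * (1 - x)) / (exp x + s * (1 + x)) = (2 - l) / l"
    proof -
      have "2 - l = (exp x + s * (1 - x)) / (exp x + s)"
        using p by (simp add: l_def field_simps)
      thus ?thesis using p by (simp add: l_def)
    qed
    finally have 2: "critN s x / (2 * d)\<^sup>2 = k\<^sup>2 * ((2 - l) / l)" .
    have "(\<Omega> - \<omega>) * (h / k * l * k') - h = h * l / k * ((\<Omega> - \<omega>) * k') - h" by simp
    also have "\<dots> = h * l / (2 * k\<^sup>2) * (2 * \<omega> - \<Omega> - critN s x / (2 * d)\<^sup>2)"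
      unfolding 1 2 using k(1) l by (simp add: field_simps power2_eq_square)
    finally show ?thesis .
  qed
  finally show "(F s has_real_derivative
      2 / g\<^sup>2 * (profile s d (\<kappa> \<omega>) * l / (2 * (\<kappa> \<omega>)\<^sup>2)) *
      (2 * \<omega> - \<Omega> - critN s x / (2 * d)\<^sup>2)) (at \<omega>)"
    by (simp only: h_def k_def mult.assoc)
qed

text \<open>The sign factor \<open>K\<close> increases because \<open>\<kappa>\<close> decreases. It
  is negative near \<open>\<Omega>\<close>, where \<open>\<kappa>\<close> blows up, and positive
  near \<open>wp\<close>, where \<open>\<kappa>\<close> vanishes and \<open>K\<close> tends to
  \<open>2 * wp - \<Omega>\<close>.\<close>

lemma F_plus_unimodal:
  assumes s: "s = 1 \<or> s = -1"
  obtains m where "\<Omega> < m" "m < wp"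
    "\<And>x y. \<Omega> < x \<Longrightarrow> x < y \<Longrightarrow> y \<le> m \<Longrightarrow> F s y < F s x"
    "\<And>x y. m \<le> x \<Longrightarrow> x < y \<Longrightarrow> y < wp \<Longrightarrow> F s x < F s y"
proof -
  define K where "K = (\<lambda>\<omega>. 2 * \<omega> - \<Omega> - critN s (2 * d * \<kappa> \<omega>) / (2 * d)\<^sup>2)"
  define C where "C = (\<lambda>\<omega>. 2 / g\<^sup>2 * (profile s d (\<kappa> \<omega>) *
    ((exp (2 * d * \<kappa> \<omega>) + s * (1 + 2 * d * \<kappa> \<omega>)) / (exp (2 * d * \<kappa> \<omega>) + s)) / (2 * (\<kappa> \<omega>)\<^sup>2)))"
  have mono: "K x < K y" if "\<Omega> < x" "x < y" "y < wp" for x y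
  proof -
    have "critN s (2 * d * \<kappa> y) < critN s (2 * d * \<kappa> x)"
      using kappa_pos[of y] kappa_strict_antimono[of x y] that d_pos
      by (intro critN_strict_mono[OF s]) auto
    hence "critN s (2 * d * \<kappa> y) / (2 * d)\<^sup>2 < critN s (2 * d * \<kappa> x) / (2 * d)\<^sup>2"
      using d_pos by (intro divide_strict_right_mono) auto
    thus ?thesis using that unfolding K_def by linarith
  qed
  have cont: "continuous_on {\<Omega><..<wp} K"
  proof (intro continuous_at_imp_continuous_on ballI)
    fix w assume w: "w \<in> {\<Omega><..<wp}"
    hence k: "\<kappa> w > 0" "2 * d * \<kappa> w > 0" using kappa_pos[of w] d_pos by auto
    note c = DERIV_isCont[OF kappa_deriv[of w]]
    have "isCont \<kappa> w" using c w by simp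
    thus "isCont K w" unfolding K_def critN_def
      using exp_sign_inequalities(3)[OF k(2) s] d_pos by (intro continuous_intros) auto
  qed
  have lim0: "((\<lambda>w. critN s (2 * d * \<kappa> w)) \<longlongrightarrow> 0) (at_left wp)"
  proof (rule filterlim_compose[OF critN_limits(1)[OF s]])
    have "filterlim (\<lambda>x. 2 * d * x) (at_right 0) (at_right 0)"
      using d_pos by real_asymp
    from filterlim_compose[OF this kappa_tendsto_0(2)]
    show "filterlim (\<lambda>w. 2 * d * \<kappa> w) (at_right 0) (at_left wp)" .
  qed
  have liminf: "filterlim (\<lambda>w. critN s (2 * d * \<kappa> w)) at_top (at_right \<Omega>)"
  proof (rule filterlim_compose[OF critN_limits(2)[OF s]])
    show "filterlim (\<lambda>w. 2 * d * \<kappa> w) at_top (at_right \<Omega>)"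
      using d_pos by (intro filterlim_tendsto_pos_mult_at_top[OF tendsto_const _ kappa_at_top(2)]) auto
  qed
  have "(K \<longlongrightarrow> 2 * wp - \<Omega> - 0 / (2 * d)\<^sup>2) (at_left wp)"
    unfolding K_def using d_pos by (intro tendsto_intros lim0) auto
  moreover have "2 * wp - \<Omega> - 0 / (2 * d)\<^sup>2 > 0" using roots Omega_pos by simp
  ultimately have "eventually (\<lambda>w. K w > 0) (at_left wp)" by (rule order_tendstoD)
  with eventually_at_left_real[OF roots(4)]
  have "eventually (\<lambda>w. w \<in> {\<Omega><..<wp} \<and> K w > 0) (at_left wp)" by (rule eventually_conj)
  then obtain v where v: "\<Omega> < v" "v < wp" "K v > 0"
    using eventually_happens'[OF trivial_limit_at_left_real] by auto
  \<comment> \<open>The threshold \<open>2 * wp\<close> exceeds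
    \<open>2 * \<omega> - \<Omega>\<close> throughout the interval, which forces
    \<open>K u < 0\<close>.\<close>
  have "eventually (\<lambda>w. critN s (2 * d * \<kappa> w) > 2 * wp * (2 * d)\<^sup>2) (at_right \<Omega>)"
    using liminf by (simp add: filterlim_at_top_dense)
  with eventually_at_right_real[OF roots(4)]
  have "eventually (\<lambda>w. w \<in> {\<Omega><..<wp} \<and> critN s (2 * d * \<kappa> w) > 2 * wp * (2 * d)\<^sup>2) (at_right \<Omega>)"
    by (rule eventually_conj)
  then obtain u where u: "\<Omega> < u" "u < wp" "critN s (2 * d * \<kappa> u) > 2 * wp * (2 * d)\<^sup>2"
    using eventually_happens'[OF trivial_limit_at_right_real] by auto
  have "critN s (2 * d * \<kappa> u) / (2 * d)\<^sup>2 > 2 * wp"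
    using u(3) d_pos by (simp add: pos_less_divide_eq)
  hence "K u < 0" using u Omega_pos unfolding K_def by linarith
  show thesis
  proof (rule unimodal_of_deriv_sign[of \<Omega> wp "F s" C K u v])
    show "(F s has_real_derivative C w * K w) (at w)" "C w > 0" if "\<Omega> < w" "w < wp" for w
      using F_plus_deriv[OF s that] by (simp_all only: C_def K_def)
  qed (use mono cont u v \<open>K u < 0\<close> that in auto)
qed

text \<open>The odd profile has the smaller denominator and is larger; the factor
  \<open>\<Omega> - \<omega>\<close> is negative here and reverses the order.\<close>

lemma F_odd_less_even:
  assumes "\<Omega> < \<omega>" "\<omega> < wp"
  shows "F (-1) \<omega> < F 1 \<omega>"
proof -
  have k: "\<kappa> \<omega> > 0" using kappa_pos[of \<omega>] assms by simp
  have "profile 1 d (\<kappa> \<omega>) < profile (-1) d (\<kappa> \<omega>)"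
    unfolding profile_def
    using k d_pos profile_pos(2)[of 1 d "\<kappa> \<omega>"] profile_pos(2)[of "-1" d "\<kappa> \<omega>"]
    by (intro divide_strict_left_mono) auto
  hence "(\<Omega> - \<omega>) * profile (-1) d (\<kappa> \<omega>) < (\<Omega> - \<omega>) * profile 1 d (\<kappa> \<omega>)"
    using assms by (intro mult_strict_left_mono_neg) auto
  thus ?thesis using g_pos by (simp add: F_def divide_strict_right_mono)
qed

lemma G_plus_min:
  shows "\<exists>!\<omega>. is_arg_min (F 1) (\<lambda>\<omega>. \<omega> \<in> G_plus g \<Omega> \<rho>) \<omega>"
    and "\<exists>!\<omega>. is_arg_min (F (-1)) (\<lambda>\<omega>. \<omega> \<in> G_plus g \<Omega> \<rho>) \<omega>"
    and "min_value (F (-1)) (G_plus g \<Omega> \<rho>) < min_value (F 1) (G_plus g \<Omega> \<rho>)"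
    and "min_value (F 1) (G_plus g \<Omega> \<rho>) < 0"
    and "s = 1 \<or> s = -1 \<Longrightarrow> finite {\<omega> \<in> G_plus g \<Omega> \<rho>. F s \<omega> = t}"
    and "s = 1 \<or> s = -1 \<Longrightarrow> card {\<omega> \<in> G_plus g \<Omega> \<rho>. F s \<omega> = t} \<in> {0, 1, 2}"
    and "\<omega> \<in> G_plus g \<Omega> \<rho> \<Longrightarrow> min_value (F (-1)) (G_plus g \<Omega> \<rho>) \<le> F (-1) \<omega>"
proof -
  obtain m where m: "\<Omega> < m" "m < wp"
    "\<And>x y. \<Omega> < x \<Longrightarrow> x < y \<Longrightarrow> y \<le> m \<Longrightarrow> F 1 y < F 1 x"
    "\<And>x y. m \<le> x \<Longrightarrow> x < y \<Longrightarrow> y < wp \<Longrightarrow> F 1 x < F 1 y"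
    using F_plus_unimodal[of 1] by auto
  obtain n where n: "\<Omega> < n" "n < wp"
    "\<And>x y. \<Omega> < x \<Longrightarrow> x < y \<Longrightarrow> y \<le> n \<Longrightarrow> F (-1) y < F (-1) x"
    "\<And>x y. n \<le> x \<Longrightarrow> x < y \<Longrightarrow> y < wp \<Longrightarrow> F (-1) x < F (-1) y"
    using F_plus_unimodal[of "-1"] by auto
  note M = unimodal_arg_min[of \<Omega> m wp "F 1", OF m, folded G_plus_def]
  note N = unimodal_arg_min[of \<Omega> n wp "F (-1)", OF n, folded G_plus_def]
  show "\<exists>!\<omega>. is_arg_min (F 1) (\<lambda>\<omega>. \<omega> \<in> G_plus g \<Omega> \<rho>) \<omega>" by (rule M(1))
  show "\<exists>!\<omega>. is_arg_min (F (-1)) (\<lambda>\<omega>. \<omega> \<in> G_plus g \<Omega> \<rho>) \<omega>" by (rule N(1))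
  show "min_value (F 1) (G_plus g \<Omega> \<rho>) < 0" using M(2) F_neg[of 1 m] m by simp
  \<comment> \<open>The odd function is compared with the even one at the even minimiser
    \<open>m\<close>.\<close>
  have "F (-1) n \<le> F (-1) m" using m by (intro N(3)) (auto simp: G_plus_def)
  also have "\<dots> < F 1 m" using F_odd_less_even m by simp
  finally show "min_value (F (-1)) (G_plus g \<Omega> \<rho>) < min_value (F 1) (G_plus g \<Omega> \<rho>)"
    using M(2) N(2) by simp
  show "s = 1 \<or> s = -1 \<Longrightarrow> finite {\<omega> \<in> G_plus g \<Omega> \<rho>. F s \<omega> = t}" using M(4) N(4) by auto
  show "s = 1 \<or> s = -1 \<Longrightarrow> card {\<omega> \<in> G_plus g \<Omega> \<rho>. F s \<omega> = t} \<in> {0, 1, 2}"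
    using M(5)[of t] N(5)[of t] by (elim disjE) simp_all
  show "\<omega> \<in> G_plus g \<Omega> \<rho> \<Longrightarrow> min_value (F (-1)) (G_plus g \<Omega> \<rho>) \<le> F (-1) \<omega>"
    using N(2,3) by simp
qed

section \<open>From secular equations to eigenvalues\<close>

text \<open>Both equations agree after multiplication by \<open>\<omega> - \<Omega>\<close> and by
  the positive denominator \<open>D\<close> of the profile.\<close>

lemma secular_iff:
  assumes s: "s = 1 \<or> s = -1" and w: "\<omega> \<noteq> \<Omega>" "\<Lambda> \<omega> < 0"
  shows "2 * \<kappa> \<omega> + g\<^sup>2 * \<mu> / (\<omega> - \<Omega>) * (1 + s * exp (- 2 * \<kappa> \<omega> * d)) = 0 \<longleftrightarrow> F s \<omega> = \<mu>"
proof -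
  define D where "D = 1 + s * exp (- 2 * \<kappa> \<omega> * d)"
  have "\<kappa> \<omega> > 0" using w by (simp add: kappa_def)
  hence D: "D > 0" unfolding D_def using profile_pos(2)[OF s d_pos] by blast
  have "F s \<omega> = \<mu> \<longleftrightarrow> 2 * ((\<Omega> - \<omega>) * \<kappa> \<omega>) = \<mu> * (g\<^sup>2 * D)"
    unfolding F_def profile_def D_def[symmetric] times_divide_eq_right times_divide_eq_left divide_divide_eq_left
    using D g_pos by (subst divide_eq_eq) (auto simp: mult_ac)
  also have "\<dots> \<longleftrightarrow> 2 * \<kappa> \<omega> * (\<omega> - \<Omega>) + g\<^sup>2 * \<mu> * D = 0"
    by (auto simp: algebra_simps)
  also have "\<dots> \<longleftrightarrow> (2 * \<kappa> \<omega> + g\<^sup>2 * \<mu> / (\<omega> - \<Omega>) * D) * (\<omega> - \<Omega>) = 0"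
    using w(1) by (simp add: distrib_right)
  finally show ?thesis using w(1) unfolding D_def by simp
qed

text \<open>Necessity comes from the interface conditions, sufficiency from the explicit
  exponentials. The third claim covers eigenfunctions without parity and serves to locate all
  eigenvalues.\<close>

lemma even_odd_eigenvalue_iff:
  shows "even_eigenvalue g \<Omega> \<rho> d \<mu> \<omega> \<longleftrightarrow> \<omega> \<in> G_minus g \<Omega> \<rho> \<union> G_plus g \<Omega> \<rho> \<and> F 1 \<omega> = \<mu>"
    and "odd_eigenvalue g \<Omega> \<rho> d \<mu> \<omega> \<longleftrightarrow> \<omega> \<in> G_minus g \<Omega> \<rho> \<union> G_plus g \<Omega> \<rho> \<and> F (-1) \<omega> = \<mu>"
    and "eigenvalue g \<Omega> \<rho> d \<mu> \<omega> \<Longrightarrow>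
           \<omega> \<in> G_minus g \<Omega> \<rho> \<union> G_plus g \<Omega> \<rho> \<and> (F 1 \<omega> = \<mu> \<or> F (-1) \<omega> = \<mu>)"
proof -
  have ne: "\<omega> \<noteq> \<Omega>" if "\<omega> \<in> G_minus g \<Omega> \<rho> \<union> G_plus g \<Omega> \<rho>"
    using that roots(3) Omega_pos by (auto simp: G_minus_def G_plus_def)
  have sec: "2 * \<kappa> \<omega> + g\<^sup>2 * \<mu> / (\<omega> - \<Omega>) * (1 + exp (- 2 * \<kappa> \<omega> * d)) = 0 \<longleftrightarrow> F 1 \<omega> = \<mu>"
    "2 * \<kappa> \<omega> + g\<^sup>2 * \<mu> / (\<omega> - \<Omega>) * (1 - exp (- 2 * \<kappa> \<omega> * d)) = 0 \<longleftrightarrow> F (-1) \<omega> = \<mu>"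
    if "\<omega> \<noteq> \<Omega>" "\<Lambda> \<omega> < 0"
    using secular_iff[of 1, OF _ that] secular_iff[of "-1", OF _ that] by simp_all
  note cond = bound_state_conditions[OF _ d_pos, of g \<Omega> \<rho> \<mu> \<omega>, folded kappa_def]
  have ex: "bound_state g \<Omega> \<rho> d \<mu> \<omega>
      (\<lambda>x. complex_of_real (exp (- \<kappa> \<omega> * \<bar>x - d\<bar>) + s * exp (- \<kappa> \<omega> * \<bar>x + d\<bar>)))"
    if "\<omega> \<in> G_minus g \<Omega> \<rho> \<union> G_plus g \<Omega> \<rho>" "F s \<omega> = \<mu>" "s = 1 \<or> s = -1" for s
  proof -
    have l: "\<Lambda> \<omega> < 0" using lam_neg_iff[OF ne[OF that(1)]] that(1) by simp
    hence "\<kappa> \<omega> > 0" "\<Lambda> \<omega> = - (\<kappa> \<omega>)\<^sup>2" by (simp_all add: kappa_def)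
    with that(2,3) secular_iff[OF that(3) ne[OF that(1)] l] d_pos show ?thesis
      by (intro bound_state_exponential) auto
  qed
  \<comment> \<open>Reflection swaps the distances to the two delta points, which gives the
    exponential state its parity.\<close>
  have refl: "\<bar>- x - d\<bar> = \<bar>x + d\<bar>" "\<bar>- x + d\<bar> = \<bar>x - d\<bar>" for x :: real by auto
  show "even_eigenvalue g \<Omega> \<rho> d \<mu> \<omega> \<longleftrightarrow> \<omega> \<in> G_minus g \<Omega> \<rho> \<union> G_plus g \<Omega> \<rho> \<and> F 1 \<omega> = \<mu>"
  proof
    assume "even_eigenvalue g \<Omega> \<rho> d \<mu> \<omega>"
    then obtain \<psi> where "\<omega> \<noteq> \<Omega>" "bound_state g \<Omega> \<rho> d \<mu> \<omega> \<psi>" "\<And>x. \<psi> (- x) = \<psi> x"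
      unfolding even_eigenvalue_def by blast
    with cond(1)[of \<psi>] cond(3)[of \<psi>] sec(1) lam_neg_iff
    show "\<omega> \<in> G_minus g \<Omega> \<rho> \<union> G_plus g \<Omega> \<rho> \<and> F 1 \<omega> = \<mu>" by blast
  next
    assume "\<omega> \<in> G_minus g \<Omega> \<rho> \<union> G_plus g \<Omega> \<rho> \<and> F 1 \<omega> = \<mu>"
    hence G: "\<omega> \<in> G_minus g \<Omega> \<rho> \<union> G_plus g \<Omega> \<rho>" and "F 1 \<omega> = \<mu>" by auto
    from ex[OF this] ne[OF G] show "even_eigenvalue g \<Omega> \<rho> d \<mu> \<omega>"
      unfolding even_eigenvalue_def
      by (intro conjI exI[of _ "\<lambda>x. complex_of_real (exp (- \<kappa> \<omega> * \<bar>x - d\<bar>) + 1 * exp (- \<kappa> \<omega> * \<bar>x + d\<bar>))"])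
        (simp_all only: refl simp_thms, simp add: add.commute)
  qed
  show "odd_eigenvalue g \<Omega> \<rho> d \<mu> \<omega> \<longleftrightarrow> \<omega> \<in> G_minus g \<Omega> \<rho> \<union> G_plus g \<Omega> \<rho> \<and> F (-1) \<omega> = \<mu>"
  proof
    assume "odd_eigenvalue g \<Omega> \<rho> d \<mu> \<omega>"
    then obtain \<psi> where "\<omega> \<noteq> \<Omega>" "bound_state g \<Omega> \<rho> d \<mu> \<omega> \<psi>" "\<And>x. \<psi> (- x) = - \<psi> x"
      unfolding odd_eigenvalue_def by blast
    with cond(1)[of \<psi>] cond(4)[of \<psi>] sec(2) lam_neg_iff
    show "\<omega> \<in> G_minus g \<Omega> \<rho> \<union> G_plus g \<Omega> \<rho> \<and> F (-1) \<omega> = \<mu>" by blast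
  next
    assume "\<omega> \<in> G_minus g \<Omega> \<rho> \<union> G_plus g \<Omega> \<rho> \<and> F (-1) \<omega> = \<mu>"
    hence G: "\<omega> \<in> G_minus g \<Omega> \<rho> \<union> G_plus g \<Omega> \<rho>" and "F (-1) \<omega> = \<mu>" by auto
    from ex[OF this] ne[OF G] show "odd_eigenvalue g \<Omega> \<rho> d \<mu> \<omega>"
      unfolding odd_eigenvalue_def
      by (intro conjI exI[of _ "\<lambda>x. complex_of_real (exp (- \<kappa> \<omega> * \<bar>x - d\<bar>) + - 1 * exp (- \<kappa> \<omega> * \<bar>x + d\<bar>))"])
        (simp_all only: refl simp_thms, simp)
  qed
  assume "eigenvalue g \<Omega> \<rho> d \<mu> \<omega>"
  then obtain \<psi> where "\<omega> \<noteq> \<Omega>" "bound_state g \<Omega> \<rho> d \<mu> \<omega> \<psi>"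
    unfolding eigenvalue_def by blast
  with cond(1)[of \<psi>] cond(2)[of \<psi>] sec lam_neg_iff
  show "\<omega> \<in> G_minus g \<Omega> \<rho> \<union> G_plus g \<Omega> \<rho> \<and> (F 1 \<omega> = \<mu> \<or> F (-1) \<omega> = \<mu>)" by blast
qed

lemma F_sign:
  assumes "s = 1 \<or> s = -1"
  shows "\<omega> \<in> G_minus g \<Omega> \<rho> \<Longrightarrow> F s \<omega> > 0" and "\<omega> \<in> G_plus g \<Omega> \<rho> \<Longrightarrow> F s \<omega> < 0"
  using F_pos[OF assms] F_neg[OF assms] by (auto simp: G_minus_def G_plus_def)

end

section \<open>Location and number of the eigenvalues\<close>

theorem mainTheorem3:
  fixes g \<Omega> \<rho>\<^sub>0 d \<mu> :: real
  assumes "g > 0" and "\<Omega> > 0" and "\<rho>\<^sub>0 > 0" and "d > 0" and "\<mu> \<noteq> 0"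
  shows "(\<forall>\<omega>. \<omega> \<noteq> \<Omega> \<longrightarrow>
            (even_eigenvalue g \<Omega> \<rho>\<^sub>0 d \<mu> \<omega> \<longleftrightarrow>
               \<omega> \<in> G_minus g \<Omega> \<rho>\<^sub>0 \<union> G_plus g \<Omega> \<rho>\<^sub>0 \<and> f_e g \<Omega> \<rho>\<^sub>0 d \<omega> = \<mu>) \<and>
            (odd_eigenvalue g \<Omega> \<rho>\<^sub>0 d \<mu> \<omega> \<longleftrightarrow>
               \<omega> \<in> G_minus g \<Omega> \<rho>\<^sub>0 \<union> G_plus g \<Omega> \<rho>\<^sub>0 \<and> f_o g \<Omega> \<rho>\<^sub>0 d \<omega> = \<mu>)) \<and>
         (\<mu> > 0 \<longrightarrow>
            (\<forall>\<omega>. eigenvalue g \<Omega> \<rho>\<^sub>0 d \<mu> \<omega> \<longrightarrow> \<omega> \<in> G_minus g \<Omega> \<rho>\<^sub>0) \<and>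
            (\<exists>!\<omega>. even_eigenvalue g \<Omega> \<rho>\<^sub>0 d \<mu> \<omega>) \<and>
            (\<mu> > mu_L g \<Omega> \<rho>\<^sub>0 d \<longrightarrow> (\<exists>!\<omega>. odd_eigenvalue g \<Omega> \<rho>\<^sub>0 d \<mu> \<omega>)) \<and>
            (\<mu> \<le> mu_L g \<Omega> \<rho>\<^sub>0 d \<longrightarrow> \<not> (\<exists>\<omega>. odd_eigenvalue g \<Omega> \<rho>\<^sub>0 d \<mu> \<omega>))) \<and>
         (\<mu> < 0 \<longrightarrow>
            (\<forall>\<omega>. eigenvalue g \<Omega> \<rho>\<^sub>0 d \<mu> \<omega> \<longrightarrow> \<omega> \<in> G_plus g \<Omega> \<rho>\<^sub>0) \<and>
            (\<exists>!\<omega>. is_arg_min (f_e g \<Omega> \<rho>\<^sub>0 d) (\<lambda>\<omega>. \<omega> \<in> G_plus g \<Omega> \<rho>\<^sub>0) \<omega>) \<and>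
            (\<exists>!\<omega>. is_arg_min (f_o g \<Omega> \<rho>\<^sub>0 d) (\<lambda>\<omega>. \<omega> \<in> G_plus g \<Omega> \<rho>\<^sub>0) \<omega>) \<and>
            min_value (f_o g \<Omega> \<rho>\<^sub>0 d) (G_plus g \<Omega> \<rho>\<^sub>0)
              < min_value (f_e g \<Omega> \<rho>\<^sub>0 d) (G_plus g \<Omega> \<rho>\<^sub>0) \<and>
            min_value (f_e g \<Omega> \<rho>\<^sub>0 d) (G_plus g \<Omega> \<rho>\<^sub>0) < 0 \<and>
            finite {\<omega>. even_eigenvalue g \<Omega> \<rho>\<^sub>0 d \<mu> \<omega>} \<and>
            card {\<omega>. even_eigenvalue g \<Omega> \<rho>\<^sub>0 d \<mu> \<omega>} \<in> {0, 1, 2} \<and>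
            finite {\<omega>. odd_eigenvalue g \<Omega> \<rho>\<^sub>0 d \<mu> \<omega>} \<and>
            card {\<omega>. odd_eigenvalue g \<Omega> \<rho>\<^sub>0 d \<mu> \<omega>} \<in> {0, 1, 2} \<and>
            (\<forall>\<^sub>F m in at_bot. \<not> (\<exists>\<omega>. eigenvalue g \<Omega> \<rho>\<^sub>0 d m \<omega>)))"
proof -
  interpret two_delta g \<Omega> \<rho>\<^sub>0 d using assms by unfold_locales
  note sgn1 = F_sign[of 1, simplified] and sgn2 = F_sign[of "-1", simplified]
  \<comment> \<open>The sign of the level functions is that of \<open>\<Omega> - \<omega>\<close>,
    so the sign of the strength selects the interval.\<close>
  have pos: "\<omega> \<in> G_minus g \<Omega> \<rho>\<^sub>0" if "\<omega> \<in> G_minus g \<Omega> \<rho>\<^sub>0 \<union> G_plus g \<Omega> \<rho>\<^sub>0" "F 1 \<omega> > 0 \<or> F (-1) \<omega> > 0" for \<omega>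
    using that sgn1(2) sgn2(2) by fastforce
  have neg: "\<omega> \<in> G_plus g \<Omega> \<rho>\<^sub>0" if "\<omega> \<in> G_minus g \<Omega> \<rho>\<^sub>0 \<union> G_plus g \<Omega> \<rho>\<^sub>0" "F 1 \<omega> < 0 \<or> F (-1) \<omega> < 0" for \<omega>
    using that sgn1(1) sgn2(1) by fastforce
  show ?thesis
    unfolding f_eq_F
  proof (intro conjI impI allI)
    assume mu: "\<mu> > 0"
    show "\<omega> \<in> G_minus g \<Omega> \<rho>\<^sub>0" if "eigenvalue g \<Omega> \<rho>\<^sub>0 d \<mu> \<omega>" for \<omega>
      using even_odd_eigenvalue_iff(3)[OF that] pos mu by blast
    have even: "even_eigenvalue g \<Omega> \<rho>\<^sub>0 d \<mu> \<omega> \<longleftrightarrow> \<omega> < wm \<and> F 1 \<omega> = \<mu>" for \<omega>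
      using even_odd_eigenvalue_iff(1)[of \<mu> \<omega>] pos[of \<omega>] mu by (auto simp: G_minus_def)
    have odd: "odd_eigenvalue g \<Omega> \<rho>\<^sub>0 d \<mu> \<omega> \<longleftrightarrow> \<omega> < wm \<and> F (-1) \<omega> = \<mu>" for \<omega>
      using even_odd_eigenvalue_iff(2)[of \<mu> \<omega>] pos[of \<omega>] mu by (auto simp: G_minus_def)
    show "\<exists>!\<omega>. even_eigenvalue g \<Omega> \<rho>\<^sub>0 d \<mu> \<omega>" unfolding even using F_minus_level(1)[OF mu] .
    show "\<exists>!\<omega>. odd_eigenvalue g \<Omega> \<rho>\<^sub>0 d \<mu> \<omega>" if "\<mu> > mu_L g \<Omega> \<rho>\<^sub>0 d"
      unfolding odd using F_minus_level(2)[OF that] .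
    show "\<not> (\<exists>\<omega>. odd_eigenvalue g \<Omega> \<rho>\<^sub>0 d \<mu> \<omega>)" if "\<mu> \<le> mu_L g \<Omega> \<rho>\<^sub>0 d"
      unfolding odd using F_minus_level(3) that by fastforce
  next
    assume mu: "\<mu> < 0"
    show "\<omega> \<in> G_plus g \<Omega> \<rho>\<^sub>0" if "eigenvalue g \<Omega> \<rho>\<^sub>0 d \<mu> \<omega>" for \<omega>
      using even_odd_eigenvalue_iff(3)[OF that] neg mu by blast
    have even: "{\<omega>. even_eigenvalue g \<Omega> \<rho>\<^sub>0 d \<mu> \<omega>} = {\<omega> \<in> G_plus g \<Omega> \<rho>\<^sub>0. F 1 \<omega> = \<mu>}"
      unfolding even_odd_eigenvalue_iff(1) using neg mu by auto
    have odd: "{\<omega>. odd_eigenvalue g \<Omega> \<rho>\<^sub>0 d \<mu> \<omega>} = {\<omega> \<in> G_plus g \<Omega> \<rho>\<^sub>0. F (-1) \<omega> = \<mu>}"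
      unfolding even_odd_eigenvalue_iff(2) using neg mu by auto
    show "finite {\<omega>. even_eigenvalue g \<Omega> \<rho>\<^sub>0 d \<mu> \<omega>}" "card {\<omega>. even_eigenvalue g \<Omega> \<rho>\<^sub>0 d \<mu> \<omega>} \<in> {0, 1, 2}"
      "finite {\<omega>. odd_eigenvalue g \<Omega> \<rho>\<^sub>0 d \<mu> \<omega>}" "card {\<omega>. odd_eigenvalue g \<Omega> \<rho>\<^sub>0 d \<mu> \<omega>} \<in> {0, 1, 2}"
      unfolding even odd by (rule G_plus_min(5) G_plus_min(6); simp)+
    let ?m = "min_value (F (-1)) (G_plus g \<Omega> \<rho>\<^sub>0)"
    \<comment> \<open>The odd minimum is a lower bound for both parities, since the even function
      lies above the odd one on \<open>G_plus\<close>.\<close>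
    have none: "\<not> (\<exists>\<omega>. eigenvalue g \<Omega> \<rho>\<^sub>0 d m \<omega>)" if "m < ?m" for m
    proof
      assume "\<exists>\<omega>. eigenvalue g \<Omega> \<rho>\<^sub>0 d m \<omega>"
      then obtain \<omega> where e: "\<omega> \<in> G_minus g \<Omega> \<rho>\<^sub>0 \<union> G_plus g \<Omega> \<rho>\<^sub>0" "F 1 \<omega> = m \<or> F (-1) \<omega> = m"
        using even_odd_eigenvalue_iff(3) by blast
      have "?m < 0" using G_plus_min(3,4) by linarith
      hence "m < 0" using that by linarith
      hence G: "\<omega> \<in> G_plus g \<Omega> \<rho>\<^sub>0" using neg e by blast
      have "?m \<le> F (-1) \<omega>" using G_plus_min(7)[OF G] .
      moreover have "F (-1) \<omega> < F 1 \<omega>" using F_odd_less_even G by (simp add: G_plus_def)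
      ultimately show False using e(2) that by linarith
    qed
    show "\<forall>\<^sub>F m in at_bot. \<not> (\<exists>\<omega>. eigenvalue g \<Omega> \<rho>\<^sub>0 d m \<omega>)"
      by (rule eventually_mono[OF eventually_gt_at_bot[of ?m]]) (rule none)
  qed (use even_odd_eigenvalue_iff(1,2) G_plus_min(1-4) in auto)
qed

end
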